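(* Let $\theta_\infty,\kappa_0\in\mathbb{C}$. Every solution $(x(z),y(z))$ of the fourth Painlevé equation $$\frac{dx}{dz}=-x^2+2xy+2xz-2\theta_\infty,\qquad \frac{dy}{dz}=-y^2+2xy-2yz-2\kappa_0$$ is meromorphic on $\mathbb{C}$; that is, every local holomorphic solution extends to a pair of meromorphic functions on the whole of $\mathbb{C}$.
   Context: The variables $x,y,z$ are complex. A solution is the one determined by an arbitrary initial condition $(x(z_0),y(z_0))=(x_0,y_0)\in\mathbb{C}^2$ at an arbitrary $z_0\in\mathbb{C}$. *)

theory Defs
  imports "HOL-Complex_Analysis.Complex_Analysis"
begin

(* For open U the complex derivatives exist in the full sense at every point of U, so x and y
   are holomorphic on U. *)
definition painleve_IV_solution_on ::
    "complex \<Rightarrow> complex \<Rightarrow> complex set \<Rightarrow> (complex \<Rightarrow> complex) \<Rightarrow> (complex \<Rightarrow> complex) \<Rightarrow> bool"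
where
  "painleve_IV_solution_on \<theta> \<kappa> U x y \<longleftrightarrow>
     (\<forall>z\<in>U.
        (x has_field_derivative
           (- (x z)\<^sup>2 + 2 * x z * y z + 2 * x z * z - 2 * \<theta>)) (at z) \<and>
        (y has_field_derivative
           (- (y z)\<^sup>2 + 2 * x z * y z - 2 * y z * z - 2 * \<kappa>)) (at z))"

end

theory Submission
  imports Defs
begin

text \<open>
  Put \<open>d = x - y - 2 * z\<close>. The Hamiltonian \<open>H = - x * y * d - 2 * \<theta> * y + 2 * \<kappa> * x\<close> satisfies
  \<open>H' = 2 * x * y\<close> along solutions. Near infinity a solution follows one of the lines \<open>y = 0\<close>,
  \<open>x = 0\<close>, \<open>d = 0\<close>, which correspond to the three types of poles, and \<open>H\<close> stays bounded at the poles
  of the first two types but not at those of the third, where \<open>H - (x + y)\<close> stays bounded. The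
  (non-holomorphic) function
  \<open>V = H - 2 * (\<bar>x\<bar>\<^sup>2 * y + \<bar>y\<bar>\<^sup>2 * x) / (\<bar>x\<bar>\<^sup>2 + \<bar>y\<bar>\<^sup>2 + 1)\<close> interpolates between the two, and
  \<open>\<bar>V'\<bar> \<le> C * (1 + \<bar>V\<bar>)\<close> holds along every path of bounded length. So \<open>V\<close> stays bounded along
  segments that avoid the poles. Boundedness of \<open>V\<close> confines \<open>(x, y)\<close> to the finite part of one of
  four charts: \<open>(x, y)\<close> itself, and the chart \<open>u = 1 / x\<close>, \<open>v = x * (2 * \<kappa> - x * y)\<close> in which the system
  is again polynomial, together with its two images under the symmetry of order three
  \<open>(x, y) \<mapsto> (- y, d)\<close>. Hence a solution that is meromorphic on a disc extends meromorphically to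
  discs of a fixed radius about a dense set of points of that disc, and so to a larger disc.
\<close>


section \<open>Holomorphic solutions of polynomial planar systems\<close>

text \<open>At a pole with \<open>d = 0\<close> both \<open>x\<close> and \<open>y\<close> behave
  like \<open>- 1 / (z - a)\<close>, so \<open>H' = 2 * x * y\<close> has a double pole there and
  the simple pole of \<open>H\<close> matches that of \<open>x + y\<close>; at the other two types
  \<open>x * y\<close> stays finite. The switch between \<open>H\<close> and
  \<open>H - (x + y)\<close> is made by comparing sizes, which brings absolute values into
  \<open>V\<close>; only real derivatives along segments are needed. The derivative of
  \<open>V\<close> is estimated in two ways, by \<open>x * y\<close> and by the square of
  \<open>x - y\<close>, and \<open>V\<close> controls the smaller of the two everywhere, also close
  to poles. All estimates start at the initial point, never at the end of an earlier stage. So the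
  bound on \<open>V\<close>, and with it the radius of local extension, depends only on the initial
  data, the parameters and the size of the region. The symmetry changes the parameters to
  \<open>- \<kappa>\<close> and \<open>1 + \<theta> - \<kappa>\<close>, hence local results are
  stated for all parameters.\<close>

inductive polynomial_rhs :: "(complex \<Rightarrow> complex \<Rightarrow> complex \<Rightarrow> complex) \<Rightarrow> bool" where
  const: "polynomial_rhs (\<lambda>_ _ _. c)"
| time: "polynomial_rhs (\<lambda>z _ _. z)"
| fst: "polynomial_rhs (\<lambda>_ x _. x)"
| snd: "polynomial_rhs (\<lambda>_ _ y. y)"
| add: "polynomial_rhs F \<Longrightarrow> polynomial_rhs G \<Longrightarrow> polynomial_rhs (\<lambda>z x y. F z x y + G z x y)"
| mult: "polynomial_rhs F \<Longrightarrow> polynomial_rhs G \<Longrightarrow> polynomial_rhs (\<lambda>z x y. F z x y * G z x y)"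

lemma polynomial_rhs_uminus:
  "polynomial_rhs F \<Longrightarrow> polynomial_rhs (\<lambda>z x y. - F z x y)"
  using polynomial_rhs.mult[OF polynomial_rhs.const[of "-1"], of F] by simp

lemma polynomial_rhs_diff:
  "polynomial_rhs F \<Longrightarrow> polynomial_rhs G \<Longrightarrow> polynomial_rhs (\<lambda>z x y. F z x y - G z x y)"
  using polynomial_rhs.add[OF _ polynomial_rhs_uminus, of F G] by simp

lemma polynomial_rhs_power:
  "polynomial_rhs F \<Longrightarrow> polynomial_rhs (\<lambda>z x y. F z x y ^ n)"
  by (induction n) (auto intro: polynomial_rhs.intros)

lemmas polynomial_rhs_intros =
  polynomial_rhs.intros polynomial_rhs_uminus polynomial_rhs_diff polynomial_rhs_power

lemma polynomial_rhs_holomorphic: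
  assumes "polynomial_rhs F" "x holomorphic_on S" "y holomorphic_on S"
  shows "(\<lambda>z. F z (x z) (y z)) holomorphic_on S"
  using assms by (induction rule: polynomial_rhs.induct) (auto intro!: holomorphic_intros)

lemma polynomial_rhs_tendsto:
  assumes "polynomial_rhs F" "(x \<longlongrightarrow> p) net" "(y \<longlongrightarrow> q) net"
  shows "((\<lambda>n. F z (x n) (y n)) \<longlongrightarrow> F z p q) net"
  using assms by (induction rule: polynomial_rhs.induct) (auto intro!: tendsto_intros)

section \<open>Bounds and Lipschitz constants of polynomial right-hand sides\<close>

definition bounded_lipschitz_rhs where
  "bounded_lipschitz_rhs F M K \<longleftrightarrow> (\<forall>z x y x' y'. norm z \<le> M \<and> norm x \<le> M \<and> norm y \<le> M \<and> norm x' \<le> M \<and> norm y' \<le> M \<longrightarrow>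
     norm (F z x y :: complex) \<le> K \<and> norm (F z x y - F z x' y') \<le> K * (norm (x - x') + norm (y - y')))"
  for M :: real and F :: "complex \<Rightarrow> complex \<Rightarrow> complex \<Rightarrow> complex"

lemma bounded_lipschitz_rhsD:
  assumes "bounded_lipschitz_rhs F M K" "norm z \<le> M" "norm x \<le> M" "norm y \<le> M"
  shows "norm (F z x y) \<le> K"
    and "norm x' \<le> M \<Longrightarrow> norm y' \<le> M \<Longrightarrow>
      norm (F z x y - F z x' y') \<le> K * (norm (x - x') + norm (y - y'))"
  using assms unfolding bounded_lipschitz_rhs_def by blast+

lemma bounded_lipschitz_rhs_mono:
  "bounded_lipschitz_rhs F M K \<Longrightarrow> K \<le> K' \<Longrightarrow> bounded_lipschitz_rhs F M K'"
  unfolding bounded_lipschitz_rhs_def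
  by (meson add_nonneg_nonneg mult_right_mono norm_ge_zero order_trans)

lemma polynomial_rhs_bounded_lipschitz:
  assumes "polynomial_rhs F"
  shows "\<exists>K. bounded_lipschitz_rhs F M K"
  using assms
proof (induction rule: polynomial_rhs.induct)
  case (const c)
  have "bounded_lipschitz_rhs (\<lambda>_ _ _. c) M (norm c)"
    by (auto simp: bounded_lipschitz_rhs_def)
  then show ?case by blast
next
  case time
  have "bounded_lipschitz_rhs (\<lambda>z _ _. z) M (max 0 M)"
    by (auto simp: bounded_lipschitz_rhs_def)
  then show ?case by blast
next
  case fst
  have "bounded_lipschitz_rhs (\<lambda>_ x _. x) M (max 1 M)"
    unfolding bounded_lipschitz_rhs_def
    by (auto intro: order_trans[OF _ mult_right_mono[of 1 "max 1 M"]])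
  then show ?case by blast
next
  case snd
  have "bounded_lipschitz_rhs (\<lambda>_ _ y. y) M (max 1 M)"
    unfolding bounded_lipschitz_rhs_def
    by (auto intro: order_trans[OF _ mult_right_mono[of 1 "max 1 M"]])
  then show ?case by blast
next
  case (add F G)
  then obtain K1 K2 where K: "bounded_lipschitz_rhs F M K1" "bounded_lipschitz_rhs G M K2" by blast
  have "bounded_lipschitz_rhs (\<lambda>z x y. F z x y + G z x y) M (K1 + K2)"
    unfolding bounded_lipschitz_rhs_def
  proof (intro allI impI conjI; elim conjE)
    fix z x y x' y' :: complex
    assume *: "norm z \<le> M" "norm x \<le> M" "norm y \<le> M" "norm x' \<le> M" "norm y' \<le> M"
    show "norm (F z x y + G z x y) \<le> K1 + K2"
      using K * unfolding bounded_lipschitz_rhs_def by (meson norm_triangle_mono)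
    have "norm ((F z x y - F z x' y') + (G z x y - G z x' y')) \<le>
      K1 * (norm (x - x') + norm (y - y')) + K2 * (norm (x - x') + norm (y - y'))"
      using K * unfolding bounded_lipschitz_rhs_def by (meson norm_triangle_mono)
    then show "norm (F z x y + G z x y - (F z x' y' + G z x' y')) \<le>
        (K1 + K2) * (norm (x - x') + norm (y - y'))"
      by (simp add: algebra_simps)
  qed
  then show ?case by blast
next
  case (mult F G)
  then obtain K1 K2 where K: "bounded_lipschitz_rhs F M K1" "bounded_lipschitz_rhs G M K2" by blast
  define K where "K = max 1 (max K1 K2)"
  have K: "bounded_lipschitz_rhs F M K" "bounded_lipschitz_rhs G M K" "K \<ge> 1"
    using K bounded_lipschitz_rhs_mono unfolding K_def by (meson max.cobounded1 max.cobounded2 order_trans)+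
  have "bounded_lipschitz_rhs (\<lambda>z x y. F z x y * G z x y) M (2 * K * K)"
    unfolding bounded_lipschitz_rhs_def
  proof (intro allI impI conjI; elim conjE)
    fix z x y x' y' :: complex
    assume *: "norm z \<le> M" "norm x \<le> M" "norm y \<le> M" "norm x' \<le> M" "norm y' \<le> M"
    have B: "norm (F z x y) \<le> K" "norm (G z x' y') \<le> K" "norm (G z x y) \<le> K"
      using K * unfolding bounded_lipschitz_rhs_def by meson+
    have "norm (F z x y) * norm (G z x y) \<le> K * K"
      using B K(3) by (intro mult_mono) auto
    also have "\<dots> \<le> 2 * K * K" using K(3) by simp
    finally show "norm (F z x y * G z x y) \<le> 2 * K * K" by (simp add: norm_mult)
    let ?D = "norm (x - x') + norm (y - y')"
    have eq: "F z x y * G z x y - F z x' y' * G z x' y' =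
      F z x y * (G z x y - G z x' y') + (F z x y - F z x' y') * G z x' y'"
      by (simp add: algebra_simps)
    have l: "norm (G z x y - G z x' y') \<le> K * ?D" "norm (F z x y - F z x' y') \<le> K * ?D"
      using K * unfolding bounded_lipschitz_rhs_def by meson+
    have "norm (F z x y * G z x y - F z x' y' * G z x' y') \<le> K * (K * ?D) + (K * ?D) * K"
      unfolding eq
      by (rule norm_triangle_mono; unfold norm_mult; rule mult_mono) (use B l K(3) in auto)
    then show "norm (F z x y * G z x y - F z x' y' * G z x' y') \<le> 2 * K * K * ?D"
      by (simp add: algebra_simps)
  qed
  then show ?case by blast
qed

lemma polynomial_rhs_common_bound:
  assumes "polynomial_rhs F" "polynomial_rhs G"
  obtains K where "K \<ge> 1" "bounded_lipschitz_rhs F M K" "bounded_lipschitz_rhs G M K"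
proof -
  obtain K1 K2 where K: "bounded_lipschitz_rhs F M K1" "bounded_lipschitz_rhs G M K2"
    using assms polynomial_rhs_bounded_lipschitz by metis
  show thesis
    by (rule that[of "max 1 (max K1 K2)"])
      (use K bounded_lipschitz_rhs_mono in \<open>meson max.cobounded1 max.cobounded2 order_trans\<close>)+
qed

section \<open>Existence and uniqueness of holomorphic solutions\<close>

definition ode_solution_on where
  "ode_solution_on F G S x y \<longleftrightarrow> (\<forall>z\<in>S. (x has_field_derivative F z (x z) (y z)) (at z) \<and>
     (y has_field_derivative G z (x z) (y z)) (at z))"
  for S :: "complex set"

lemma ode_solution_on_holomorphic:
  assumes "ode_solution_on F G S x y"
  shows "x holomorphic_on S" "y holomorphic_on S"
  using assms unfolding ode_solution_on_def holomorphic_on_def field_differentiable_def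
  by (meson has_field_derivative_at_within)+

lemma has_field_derivative_ball_bound:
  fixes f :: "complex \<Rightarrow> complex"
  assumes "\<And>w. w \<in> ball a r \<Longrightarrow> (f has_field_derivative f' w) (at w)"
    and "\<And>w. w \<in> ball a r \<Longrightarrow> norm (f' w) \<le> B" and "z \<in> ball a r"
  shows "norm (f z - f a) \<le> B * r"
proof -
  have "a \<in> ball a r" using assms(3) by (simp add: order_le_less_trans[OF zero_le_dist])
  then have B: "0 \<le> B" using assms(2) norm_ge_zero order_trans by blast
  have "norm (f z - f a) \<le> B * norm (z - a)"
    by (rule field_differentiable_bound[of "ball a r" f f'])
      (use assms \<open>a \<in> _\<close> in \<open>auto intro: has_field_derivative_at_within\<close>)
  also have "\<dots> \<le> B * r"
    using assms(3) B by (intro mult_left_mono) (auto simp: dist_norm norm_minus_commute)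
  finally show ?thesis .
qed

text \<open>Picard iteration. The radius is uniform because all initial data of size at most
  \<open>M\<close> have the same margin 1 to the region of size \<open>M + 1\<close>, where one
  constant \<open>K\<close> governs both right-hand sides.\<close>

lemma polynomial_ode_uniform_existence:
  assumes F: "polynomial_rhs F" and G: "polynomial_rhs G"
  obtains r where "r > 0"
    "\<And>a p q. norm a \<le> M \<Longrightarrow> norm p \<le> M \<Longrightarrow> norm q \<le> M \<Longrightarrow>
       \<exists>x y. x a = p \<and> y a = q \<and> ode_solution_on F G (ball a r) x y"
proof -
  obtain K where K: "K \<ge> 1" and LF: "bounded_lipschitz_rhs F (M + 1) K"
    and LG: "bounded_lipschitz_rhs G (M + 1) K"
    using polynomial_rhs_common_bound[OF F G] by blast
  \<comment> \<open>\<open>r \<le> 1\<close> keeps the time within \<open>M + 1\<close>,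
    \<open>K * r \<le> 1\<close> keeps the iterates there, and \<open>2 * K * r \<le> 1/2\<close>
    halves the increments; the 2 counts the components.\<close>
  define r where "r = 1 / (4 * K)"
  have r: "0 < r" "r \<le> 1" "K * r \<le> 1" "2 * K * r \<le> 1/2"
    using K by (auto simp: r_def field_simps)
  show thesis
  proof (rule that[OF r(1)])
    fix a p q :: complex
    assume a: "norm a \<le> M" and p: "norm p \<le> M" and q: "norm q \<le> M"
    let ?B = "ball a r"
    have zB: "norm z \<le> M + 1" if "z \<in> ?B" for z
    proof -
      have "norm z \<le> norm a + norm (z - a)" by (metis norm_triangle_sub)
      then show ?thesis using that a r(2) by (simp add: dist_norm norm_minus_commute)
    qed
    \<comment> \<open>A primitive on the disc is only known to exist, so the iterates come from
      dependent choice: \<open>P\<close> is the invariant, \<open>Q\<close> links consecutive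
      pairs.\<close>
    define P :: "nat \<Rightarrow> (complex \<Rightarrow> complex) \<times> (complex \<Rightarrow> complex) \<Rightarrow> bool" where
      "P = (\<lambda>_ s. fst s holomorphic_on ?B \<and> snd s holomorphic_on ?B \<and> fst s a = p \<and> snd s a = q \<and>
         (\<forall>z\<in>?B. norm (fst s z) \<le> M + 1 \<and> norm (snd s z) \<le> M + 1))"
    define Q :: "nat \<Rightarrow> (complex \<Rightarrow> complex) \<times> (complex \<Rightarrow> complex) \<Rightarrow> (complex \<Rightarrow> complex) \<times> (complex \<Rightarrow> complex) \<Rightarrow> bool" where
      "Q = (\<lambda>_ s s'. \<forall>z\<in>?B. (fst s' has_field_derivative F z (fst s z) (snd s z)) (at z) \<and>
          (snd s' has_field_derivative G z (fst s z) (snd s z)) (at z))"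
    have primitive: "\<exists>x. x a = p \<and> x holomorphic_on ?B \<and> (\<forall>z\<in>?B. norm (x z) \<le> M + 1) \<and>
        (\<forall>z\<in>?B. (x has_field_derivative E z (fst s z) (snd s z)) (at z))"
      if E: "polynomial_rhs E" "bounded_lipschitz_rhs E (M + 1) K" and s: "P n s" and p: "norm p \<le> M" for E p n s
    proof -
      have hol: "(\<lambda>z. E z (fst s z) (snd s z)) holomorphic_on ?B"
        using polynomial_rhs_holomorphic[OF E(1)] s by (simp add: P_def)
      obtain g where g: "\<And>z. z \<in> ?B \<Longrightarrow> (g has_field_derivative E z (fst s z) (snd s z)) (at z within ?B)"
        using holomorphic_convex_primitive'[OF convex_ball open_ball hol] by metis
      define x where "x z = g z - g a + p" for z
      have x: "(x has_field_derivative E z (fst s z) (snd s z)) (at z)" if "z \<in> ?B" for z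
      proof -
        have "(g has_field_derivative E z (fst s z) (snd s z)) (at z)"
          using g[OF that] that at_within_open[OF that open_ball] by simp
        then have "((\<lambda>z. g z - g a + p) has_field_derivative E z (fst s z) (snd s z) - 0 + 0) (at z)"
          by (intro DERIV_add DERIV_diff DERIV_const)
        then show ?thesis unfolding x_def by simp
      qed
      have Eb: "norm (E z (fst s z) (snd s z)) \<le> K" if "z \<in> ?B" for z
        using s that by (intro bounded_lipschitz_rhsD(1)[OF E(2) zB[OF that]]) (auto simp: P_def)
      have "norm (x z) \<le> M + 1" if z: "z \<in> ?B" for z
        using has_field_derivative_ball_bound[OF x Eb z] p r(3) norm_triangle_sub[of "x z" p]
        by (simp add: x_def)
      moreover have "x holomorphic_on ?B"
        using x holomorphic_on_open by blast
      ultimately show ?thesis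
        using x by (intro exI[of _ x]) (auto simp: x_def)
    qed
    have "\<exists>s. \<forall>n. P n (s n) \<and> Q n (s n) (s (Suc n))"
    proof (rule dependent_nat_choice)
      show "\<exists>s. P 0 s"
        by (rule exI[of _ "(\<lambda>_. p, \<lambda>_. q)"]) (use p q in \<open>auto simp: P_def\<close>)
      show "\<exists>s'. P (Suc n) s' \<and> Q n s s'" if Pn: "P n s" for s n
      proof -
        obtain x where x: "x a = p" "x holomorphic_on ?B" "\<forall>z\<in>?B. norm (x z) \<le> M + 1"
          "\<forall>z\<in>?B. (x has_field_derivative F z (fst s z) (snd s z)) (at z)"
          using primitive[OF F LF Pn p] by (elim exE conjE)
        obtain y where y: "y a = q" "y holomorphic_on ?B" "\<forall>z\<in>?B. norm (y z) \<le> M + 1"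
          "\<forall>z\<in>?B. (y has_field_derivative G z (fst s z) (snd s z)) (at z)"
          using primitive[OF G LG Pn q] by (elim exE conjE)
        from x y show ?thesis
          by (intro exI[of _ "(x, y)"]) (auto simp: P_def Q_def)
      qed
    qed
    then obtain s where P: "\<And>n. P n (s n)" and Q: "\<And>n. Q n (s n) (s (Suc n))" by blast
    define X Y where "X n = fst (s n)" and "Y n = snd (s n)" for n
    have bnd: "norm (X n z) \<le> M + 1" "norm (Y n z) \<le> M + 1" if "z \<in> ?B" for n z
      using P[of n] that by (auto simp: P_def X_def Y_def)
    have init: "X n a = p" "Y n a = q" for n
      using P[of n] by (auto simp: P_def X_def Y_def)
    have der: "(X (Suc n) has_field_derivative F z (X n z) (Y n z)) (at z)"
      "(Y (Suc n) has_field_derivative G z (X n z) (Y n z)) (at z)" if "z \<in> ?B" for n z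
      using Q[of n] that by (auto simp: Q_def X_def Y_def)
    \<comment> \<open>The start \<open>4 * M + 4\<close> comes from four values of norm at most
      \<open>M + 1\<close>.\<close>
    have step: "norm (X (Suc n) z - X n z) + norm (Y (Suc n) z - Y n z) \<le> (4 * M + 4) * (1/2) ^ n" if "z \<in> ?B" for n z
      using that
    proof (induction n arbitrary: z)
      case 0
      show ?case
        using bnd[OF 0, of 0] bnd[OF 0, of 1] norm_triangle_ineq4[of "X 1 z" "X 0 z"]
          norm_triangle_ineq4[of "Y 1 z" "Y 0 z"] by simp
    next
      case (Suc n)
      define D where "D = (4 * M + 4) * (1/2) ^ n"
      have L: "norm (E w (X (Suc n) w) (Y (Suc n) w) - E w (X n w) (Y n w)) \<le> K * D"
        if "bounded_lipschitz_rhs E (M + 1) K" "w \<in> ?B" for E w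
      proof -
        have "norm (E w (X (Suc n) w) (Y (Suc n) w) - E w (X n w) (Y n w)) \<le>
          K * (norm (X (Suc n) w - X n w) + norm (Y (Suc n) w - Y n w))"
          by (rule bounded_lipschitz_rhsD(2)[OF that(1) zB[OF that(2)]]) (rule bnd[OF that(2)])+
        also have "\<dots> \<le> K * D"
          using Suc.IH[OF that(2)] K by (simp add: D_def mult_left_mono)
        finally show ?thesis .
      qed
      have "norm ((X (Suc (Suc n)) z - X (Suc n) z) - (X (Suc (Suc n)) a - X (Suc n) a)) \<le> K * D * r"
        by (rule has_field_derivative_ball_bound[OF DERIV_diff[OF der(1) der(1)]])
          (use L[OF LF] Suc.prems in auto)
      moreover have "norm ((Y (Suc (Suc n)) z - Y (Suc n) z) - (Y (Suc (Suc n)) a - Y (Suc n) a)) \<le> K * D * r"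
        by (rule has_field_derivative_ball_bound[OF DERIV_diff[OF der(2) der(2)]])
          (use L[OF LG] Suc.prems in auto)
      ultimately have "norm (X (Suc (Suc n)) z - X (Suc n) z) + norm (Y (Suc (Suc n)) z - Y (Suc n) z) \<le> (2 * K * r) * D"
        using mult_2[of "K * D * r"] by (simp add: init mult_ac)
      also have "\<dots> \<le> 1/2 * D"
        using r(4) order_trans[OF norm_ge_zero p] by (intro mult_right_mono) (auto simp: D_def)
      finally show ?case by (simp add: D_def)
    qed
    have lim: "\<exists>x. uniform_limit ?B W x sequentially"
      if W: "\<And>n z. z \<in> ?B \<Longrightarrow> norm (W (Suc n) z - W n z) \<le> (4 * M + 4) * (1/2) ^ n"
      for W :: "nat \<Rightarrow> complex \<Rightarrow> complex"
    proof -
      have "summable (\<lambda>n. (4 * M + 4) * (1/2::real) ^ n)"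
        by (intro summable_mult summable_geometric) auto
      then have "uniform_limit ?B (\<lambda>n z. \<Sum>i<n. W (Suc i) z - W i z) (\<lambda>z. \<Sum>i. W (Suc i) z - W i z) sequentially"
        by (intro Weierstrass_m_test[OF W]) auto
      then have "uniform_limit ?B (\<lambda>n z. (\<Sum>i<n. W (Suc i) z - W i z) + W 0 z)
          (\<lambda>z. (\<Sum>i. W (Suc i) z - W i z) + W 0 z) sequentially"
        by (intro uniform_limit_intros)
      moreover have "(\<Sum>i<n. W (Suc i) z - W i z) + W 0 z = W n z" for n z
        using sum_lessThan_telescope[of "\<lambda>n. W n z" n] by simp
      ultimately show ?thesis by auto
    qed
    have "\<exists>x. uniform_limit ?B X x sequentially"
      by (rule lim) (rule order_trans[OF _ step], auto)
    then obtain x where x: "uniform_limit ?B X x sequentially" by blast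
    have "\<exists>y. uniform_limit ?B Y y sequentially"
      by (rule lim) (rule order_trans[OF _ step], auto)
    then obtain y where y: "uniform_limit ?B Y y sequentially" by blast
    \<comment> \<open>Derivatives pass to the limit under uniform convergence, and continuity of the
      polynomial identifies what they converge to.\<close>
    have limder: "(w has_field_derivative E z (x z) (y z)) (at z)"
      if W: "uniform_limit ?B W w sequentially" and E: "polynomial_rhs E" and z: "z \<in> ?B"
        and d: "\<And>n z. z \<in> ?B \<Longrightarrow> (W (Suc n) has_field_derivative E z (X n z) (Y n z)) (at z)" for W w E z
    proof -
      have "uniform_limit ?B (\<lambda>n. W (Suc n)) w sequentially"
        using W unfolding uniform_limit_iff by (simp add: eventually_all_ge_at_top eventually_sequentially) (meson le_SucI)
      then have "\<exists>d>0. cball z d \<subseteq> ?B \<and> uniform_limit (cball z d) (\<lambda>n. W (Suc n)) w sequentially"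
        if "z \<in> ?B" for z
        using that open_contains_cball[of ?B] uniform_limit_on_subset by (metis open_ball)
      then obtain w' where w': "\<forall>z\<in>?B. (w has_field_derivative w' z) (at z) \<and> (\<lambda>n. E z (X n z) (Y n z)) \<longlonglongrightarrow> w' z"
        using has_complex_derivative_uniform_sequence[of ?B "\<lambda>n. W (Suc n)" "\<lambda>n z. E z (X n z) (Y n z)" w] d by auto
      have "(\<lambda>n. E z (X n z) (Y n z)) \<longlonglongrightarrow> E z (x z) (y z)"
        using polynomial_rhs_tendsto[OF E] tendsto_uniform_limitI[OF x z] tendsto_uniform_limitI[OF y z] by blast
      then show ?thesis using w' z LIMSEQ_unique by fastforce
    qed
    have "a \<in> ?B" using r by simp
    have "(\<lambda>n. X n a) \<longlonglongrightarrow> x a" "(\<lambda>n. Y n a) \<longlonglongrightarrow> y a"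
      using tendsto_uniform_limitI[OF x \<open>a \<in> ?B\<close>] tendsto_uniform_limitI[OF y \<open>a \<in> ?B\<close>] by auto
    then have "x a = p" "y a = q"
      by (auto simp: init LIMSEQ_const_iff)
    moreover have "ode_solution_on F G ?B x y"
      unfolding ode_solution_on_def using limder[OF x F] limder[OF y G] der by blast
    ultimately show "\<exists>x y. x a = p \<and> y a = q \<and> ode_solution_on F G ?B x y" by blast
  qed
qed

text \<open>On a disc with \<open>2 * K * r \<le> 1/2\<close> any bound for the difference of the
  solutions can be halved, since the difference vanishes at \<open>a\<close> and its derivative is
  controlled by the Lipschitz constant. Iteration leaves only 0.\<close>

lemma polynomial_ode_unique:
  assumes F: "polynomial_rhs F" and G: "polynomial_rhs G"
    and "open S" "a \<in> S" and sol1: "ode_solution_on F G S x y" and sol2: "ode_solution_on F G S x' y'"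
    and init: "x a = x' a" "y a = y' a"
  shows "\<exists>r>0. ball a r \<subseteq> S \<and> (\<forall>z\<in>ball a r. x z = x' z \<and> y z = y' z)"
proof -
  \<comment> \<open>Compactness of this closed disc supplies one bound \<open>M\<close> for all four
    components and the time.\<close>
  obtain e where e: "e > 0" "cball a e \<subseteq> S"
    using \<open>open S\<close> \<open>a \<in> S\<close> open_contains_cball by blast
  have cont: "continuous_on (cball a e) f" if "f \<in> {x, y, x', y'}" for f
    using that ode_solution_on_holomorphic[OF sol1] ode_solution_on_holomorphic[OF sol2] e(2)
      holomorphic_on_imp_continuous_on continuous_on_subset by blast
  have "\<exists>M. \<forall>z\<in>cball a e. norm (f z) \<le> M" if "f \<in> {x, y, x', y', \<lambda>z. z}" for f
  proof -
    have "compact (f ` cball a e)"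
      using that cont by (intro compact_continuous_image) (auto intro: continuous_on_id)
    then show ?thesis by (auto dest!: compact_imp_bounded simp: bounded_iff)
  qed
  then obtain M1 M2 M3 M4 M5 where M: "\<And>z. z \<in> cball a e \<Longrightarrow> norm (x z) \<le> M1"
    "\<And>z. z \<in> cball a e \<Longrightarrow> norm (y z) \<le> M2" "\<And>z. z \<in> cball a e \<Longrightarrow> norm (x' z) \<le> M3"
    "\<And>z. z \<in> cball a e \<Longrightarrow> norm (y' z) \<le> M4" "\<And>z. z \<in> cball a e \<Longrightarrow> norm z \<le> M5"
    by (metis insertCI)
  define M where "M = Max {M1, M2, M3, M4, M5}"
  have le: "M1 \<le> M" "M2 \<le> M" "M3 \<le> M" "M4 \<le> M" "M5 \<le> M"
    by (auto simp: M_def)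
  have M: "norm (x z) \<le> M \<and> norm (y z) \<le> M \<and> norm (x' z) \<le> M \<and> norm (y' z) \<le> M \<and> norm z \<le> M"
    if "z \<in> cball a e" for z
    using M[OF that] le by linarith
  obtain K where K: "K \<ge> 1" and LF: "bounded_lipschitz_rhs F M K"
    and LG: "bounded_lipschitz_rhs G M K"
    using polynomial_rhs_common_bound[OF F G] by blast
  define r where "r = min e (1 / (4 * K))"
  have r: "0 < r" "r \<le> e" "2 * K * r \<le> 1/2"
    using K e by (auto simp: r_def field_simps min_def)
  let ?d = "\<lambda>z. norm (x z - x' z) + norm (y z - y' z)"
  have sub: "ball a r \<subseteq> cball a e" "ball a r \<subseteq> S" using r(2) e(2) by auto
  have bound: "?d z \<le> 4 * M * (1/2) ^ n" if "z \<in> ball a r" for n z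
    using that
  proof (induction n arbitrary: z)
    case 0
    then show ?case
      using M[of z] sub norm_triangle_ineq4[of "x z" "x' z"] norm_triangle_ineq4[of "y z" "y' z"] by fastforce
  next
    case (Suc n)
    have L: "norm (E w (x w) (y w) - E w (x' w) (y' w)) \<le> K * (4 * M * (1/2) ^ n)"
      if "bounded_lipschitz_rhs E M K" "w \<in> ball a r" for E w
    proof -
      have "norm (E w (x w) (y w) - E w (x' w) (y' w)) \<le> K * ?d w"
        by (rule bounded_lipschitz_rhsD(2)[OF that(1)]) (use M sub(1) that(2) in blast)+
      also have "\<dots> \<le> K * (4 * M * (1/2) ^ n)"
        using Suc.IH[OF that(2)] K by (intro mult_left_mono) auto
      finally show ?thesis .
    qed
    have d: "((\<lambda>z. x z - x' z) has_field_derivative F w (x w) (y w) - F w (x' w) (y' w)) (at w)"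
      "((\<lambda>z. y z - y' z) has_field_derivative G w (x w) (y w) - G w (x' w) (y' w)) (at w)"
      if "w \<in> ball a r" for w
      using sol1 sol2 that sub(2) unfolding ode_solution_on_def by (blast intro: DERIV_diff)+
    have "norm ((x z - x' z) - (x a - x' a)) \<le> K * (4 * M * (1/2) ^ n) * r"
      by (rule has_field_derivative_ball_bound[OF d(1)]) (use L[OF LF] Suc.prems in auto)
    moreover have "norm ((y z - y' z) - (y a - y' a)) \<le> K * (4 * M * (1/2) ^ n) * r"
      by (rule has_field_derivative_ball_bound[OF d(2)]) (use L[OF LG] Suc.prems in auto)
    ultimately have "?d z \<le> (2 * K * r) * (4 * M * (1/2) ^ n)"
      using mult_2[of "K * (4 * M * (1/2) ^ n) * r"] by (simp add: init mult_ac)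
    also have "\<dots> \<le> 1/2 * (4 * M * (1/2) ^ n)"
      using r(3) order_trans[OF norm_ge_zero, of "x a" M] M[of a] e(1) by (intro mult_right_mono) auto
    finally show ?case by simp
  qed
  have "?d z = 0" if "z \<in> ball a r" for z
  proof -
    have "(\<lambda>n. 4 * M * (1/2::real) ^ n) \<longlonglongrightarrow> 4 * M * 0"
      by (intro tendsto_intros LIMSEQ_power_zero) auto
    then have "?d z \<le> 0"
      using bound[OF that] by (intro LIMSEQ_le_const[where X="\<lambda>n. 4 * M * (1/2::real) ^ n"]) auto
    then show ?thesis by (simp add: add_nonneg_nonneg order_antisym)
  qed
  then have "\<forall>z\<in>ball a r. x z = x' z \<and> y z = y' z"
    by (simp add: add_nonneg_eq_0_iff)
  then show ?thesis using r(1) sub(2) by blast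
qed

section \<open>The Lyapunov function\<close>

definition piv_x :: "complex \<Rightarrow> complex \<Rightarrow> complex \<Rightarrow> complex \<Rightarrow> complex" where
  "piv_x \<theta> z x y = - x\<^sup>2 + 2 * x * y + 2 * x * z - 2 * \<theta>"

definition piv_y :: "complex \<Rightarrow> complex \<Rightarrow> complex \<Rightarrow> complex \<Rightarrow> complex" where
  "piv_y \<kappa> z x y = - y\<^sup>2 + 2 * x * y - 2 * y * z - 2 * \<kappa>"

text \<open>Sign convention: \<open>piv_x\<close> is the partial derivative in \<open>y\<close>, and
  \<open>piv_y\<close> is minus the one in \<open>x\<close>.\<close>

definition piv_H :: "complex \<Rightarrow> complex \<Rightarrow> complex \<Rightarrow> complex \<Rightarrow> complex \<Rightarrow> complex" where
  "piv_H \<theta> \<kappa> z x y = - (x * y * (x - y - 2 * z)) - 2 * \<theta> * y + 2 * \<kappa> * x"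

text \<open>Each component is weighted by the squared size of the other. The quotient is nearly
  \<open>x + y\<close> for large \<open>x\<close>, \<open>y\<close> of equal modulus and small when
  \<open>x * y\<close> is; the summand 1 keeps the denominator positive at the origin.\<close>

definition piv_corr :: "complex \<Rightarrow> complex \<Rightarrow> complex" where
  "piv_corr x y = (2 *\<^sub>R ((norm x)\<^sup>2 *\<^sub>R y + (norm y)\<^sup>2 *\<^sub>R x)) /\<^sub>R ((norm x)\<^sup>2 + (norm y)\<^sup>2 + 1)"

definition piv_V :: "complex \<Rightarrow> complex \<Rightarrow> complex \<Rightarrow> complex \<Rightarrow> complex \<Rightarrow> complex" where
  "piv_V \<theta> \<kappa> z x y = piv_H \<theta> \<kappa> z x y - piv_corr x y"

text \<open>The difference of the squared moduli is the inner product of \<open>x - y\<close> and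
  \<open>x + y\<close>. This form serves near \<open>d = 0\<close>, where \<open>x - y\<close> is
  under control although \<open>x\<close> and \<open>y\<close> are not.\<close>

lemma piv_corr_alt:
  "piv_corr x y = (x + y) - (((x - y) \<bullet> (x + y)) *\<^sub>R (x - y) + (x + y)) /\<^sub>R ((norm x)\<^sup>2 + (norm y)\<^sup>2 + 1)"
proof -
  define N where "N = (norm x)\<^sup>2 + (norm y)\<^sup>2 + 1"
  have "N > 0" by (simp add: N_def add_nonneg_pos)
  have d: "(x - y) \<bullet> (x + y) = (norm x)\<^sup>2 - (norm y)\<^sup>2"
    by (simp add: power2_norm_eq_inner inner_diff_left inner_diff_right inner_add_right inner_add_left inner_commute)
  have "2 *\<^sub>R ((norm x)\<^sup>2 *\<^sub>R y + (norm y)\<^sup>2 *\<^sub>R x) =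
     N *\<^sub>R (x + y) - (((norm x)\<^sup>2 - (norm y)\<^sup>2) *\<^sub>R (x - y) + (x + y))"
    unfolding N_def by (simp add: scaleR_conv_of_real algebra_simps)
  then show ?thesis
    using \<open>N > 0\<close> unfolding piv_corr_def d N_def[symmetric] by (simp add: scaleR_diff_right)
qed

lemma norm_piv_corr_le: "norm (piv_corr x y) \<le> 2 * (norm x + norm y)"
proof -
  define N where "N = (norm x)\<^sup>2 + (norm y)\<^sup>2 + 1"
  have N: "N > 0" "(norm x)\<^sup>2 \<le> N" "(norm y)\<^sup>2 \<le> N" by (simp_all add: N_def add_nonneg_pos)
  have "norm (2 *\<^sub>R ((norm x)\<^sup>2 *\<^sub>R y + (norm y)\<^sup>2 *\<^sub>R x)) \<le> 2 * ((norm x)\<^sup>2 * norm y + (norm y)\<^sup>2 * norm x)"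
    using norm_triangle_ineq[of "(norm x)\<^sup>2 *\<^sub>R y" "(norm y)\<^sup>2 *\<^sub>R x"] by simp
  also have "\<dots> \<le> 2 * (N * norm y + N * norm x)"
    using N by (intro mult_left_mono add_mono mult_right_mono) auto
  finally have "norm (piv_corr x y) \<le> inverse N * (2 * (N * norm y + N * norm x))"
    using N(1) unfolding piv_corr_def N_def[symmetric] norm_scaleR[of "inverse N"]
    by (simp only: abs_of_pos positive_imp_inverse_positive) (intro mult_left_mono; simp)
  then have "N * norm (piv_corr x y) \<le> N * (2 * (norm x + norm y))"
    using N(1) by (simp add: field_simps)
  then show ?thesis using N(1) by (rule mult_left_le_imp_le)
qed

section \<open>The derivative of \<open>V\<close> along a curve\<close>

lemma has_real_derivative_norm_power2:
  fixes f :: "real \<Rightarrow> complex"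
  assumes "(f has_vector_derivative f') (at t within S)"
  shows "((\<lambda>t. (norm (f t))\<^sup>2) has_real_derivative 2 * (f t \<bullet> f')) (at t within S)"
  unfolding power2_norm_eq_inner has_real_derivative_iff_has_vector_derivative
  using assms
  by (auto intro!: derivative_eq_intros simp: has_vector_derivative_def inner_commute algebra_simps)

text \<open>The quotient rule, with the denominator written as a square so that all terms compare by
  powers of \<open>n\<close>. It is applied to both forms of the correction.\<close>

lemma has_vector_derivative_quotient_bound:
  fixes A :: "real \<Rightarrow> complex"
  assumes N: "(N has_real_derivative N') (at t within S)" and A: "(A has_vector_derivative A') (at t within S)"
    and n: "N t = n\<^sup>2" "n \<ge> 1" and bounds: "\<bar>N'\<bar> \<le> \<nu>" "norm (A t) \<le> \<alpha>" "norm A' \<le> \<alpha>'"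
  obtains D where "((\<lambda>t. A t /\<^sub>R N t) has_vector_derivative D) (at t within S)"
    and "norm D \<le> \<alpha>' / n\<^sup>2 + \<nu> * \<alpha> / n ^ 4"
proof
  have "n \<noteq> 0" using n(2) by simp
  have "((\<lambda>t. inverse (N t)) has_real_derivative - N' / (n\<^sup>2)\<^sup>2) (at t within S)"
    using N n \<open>n \<noteq> 0\<close> by (auto intro!: derivative_eq_intros simp: power2_eq_square field_simps)
  from has_vector_derivative_scaleR[OF this A]
  show "((\<lambda>t. A t /\<^sub>R N t) has_vector_derivative A' /\<^sub>R n\<^sup>2 + (- N' / (n\<^sup>2)\<^sup>2) *\<^sub>R A t) (at t within S)"
    by (simp add: n(1))
  have "norm (A' /\<^sub>R n\<^sup>2 + (- N' / (n\<^sup>2)\<^sup>2) *\<^sub>R A t) \<le> norm A' / n\<^sup>2 + \<bar>N'\<bar> * norm (A t) / n ^ 4"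
    by (rule norm_triangle_le) (simp add: field_simps)
  also have "\<dots> \<le> \<alpha>' / n\<^sup>2 + \<nu> * \<alpha> / n ^ 4"
    using bounds abs_ge_zero[of N'] by (intro add_mono divide_right_mono mult_mono) (auto intro: order_trans[OF abs_ge_zero])
  finally show "norm (A' /\<^sub>R n\<^sup>2 + (- N' / (n\<^sup>2)\<^sup>2) *\<^sub>R A t) \<le> \<alpha>' / n\<^sup>2 + \<nu> * \<alpha> / n ^ 4" .
qed

text \<open>All terms of \<open>piv_x\<close> but the constant contain \<open>x\<close>, so the
  growth is \<open>norm x * n\<close> rather than \<open>n\<^sup>2\<close>; this factor later
  produces products \<open>norm x * norm y\<close>. Including \<open>\<kappa>\<close> makes the
  constant the same for both components.\<close>

lemma norm_piv_x_le:
  assumes "norm z \<le> L" "norm x \<le> n" "norm y \<le> n" "1 \<le> n"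
  shows "norm (piv_x \<theta> z x y) \<le> (3 + 2 * L + 2 * norm \<theta> + 2 * norm \<kappa>) * (norm x * n + 1)"
proof -
  have L: "0 \<le> L" using assms(1) norm_ge_zero order_trans by blast
  have "piv_x \<theta> z x y = x * (- x + 2 * y + 2 * z) - 2 * \<theta>"
    by (simp add: piv_x_def algebra_simps power2_eq_square)
  also have "norm \<dots> \<le> norm x * norm (- x + 2 * y + 2 * z) + 2 * norm \<theta>"
    by (rule order_trans[OF norm_triangle_ineq4]) (simp add: norm_mult)
  finally have 1: "norm (piv_x \<theta> z x y) \<le> norm x * norm (- x + 2 * y + 2 * z) + 2 * norm \<theta>" .
  have "norm (- x + 2 * y + 2 * z) \<le> norm x + 2 * norm y + 2 * norm z"
    using norm_triangle_ineq[of "- x + 2 * y" "2 * z"] norm_triangle_ineq[of "-x" "2 * y"] by (simp add: norm_mult)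
  also have "\<dots> \<le> (3 + 2 * L) * n"
    using assms mult_left_mono[of 1 n "2 * L"] L by (simp add: algebra_simps)
  finally have "norm x * norm (- x + 2 * y + 2 * z) \<le> norm x * ((3 + 2 * L) * n)"
    by (rule mult_left_mono) simp
  with 1 have "norm (piv_x \<theta> z x y) \<le> (3 + 2 * L) * (norm x * n) + 2 * norm \<theta>"
    by (simp add: mult_ac)
  also have "\<dots> \<le> (3 + 2 * L + 2 * norm \<theta> + 2 * norm \<kappa>) * (norm x * n + 1)"
    using L assms(4) by (simp add: algebra_simps)
  finally show ?thesis .
qed

lemma norm_piv_y_le:
  assumes "norm z \<le> L" "norm x \<le> n" "norm y \<le> n" "1 \<le> n"
  shows "norm (piv_y \<kappa> z x y) \<le> (3 + 2 * L + 2 * norm \<theta> + 2 * norm \<kappa>) * (norm y * n + 1)"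
proof -
  have "piv_y \<kappa> z x y = piv_x \<kappa> (- z) y x" by (simp add: piv_x_def piv_y_def)
  then show ?thesis
    using norm_piv_x_le[of "-z" L y n x \<kappa> \<theta>] assms by (simp add: algebra_simps)
qed

text \<open>A solution at one parameter value \<open>t\<close> of a path with velocity
  \<open>e\<close>, which enters by the chain rule. Below, \<open>n\<close> is the square root of
  the denominator of \<open>piv_corr\<close> and the unit of growth.\<close>

locale piv_curve =
  fixes X Y Z :: "real \<Rightarrow> complex" and e \<theta> \<kappa> :: complex and t L :: real and S :: "real set"
  assumes X: "(X has_vector_derivative e * piv_x \<theta> (Z t) (X t) (Y t)) (at t within S)"
    and Y: "(Y has_vector_derivative e * piv_y \<kappa> (Z t) (X t) (Y t)) (at t within S)"
    and Z: "(Z has_vector_derivative e) (at t within S)"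
    and L: "norm (Z t) \<le> L"
begin

definition "n = sqrt ((norm (X t))\<^sup>2 + (norm (Y t))\<^sup>2 + 1)"
definition "c = 3 + 2 * L + 2 * norm \<theta> + 2 * norm \<kappa>"
definition "C = norm e * c"

lemma L_ge_0: "0 \<le> L"
  using L norm_ge_zero order_trans by blast

lemma c_ge_3: "3 \<le> c"
  using L_ge_0 by (simp add: c_def)

lemma C_ge: "3 * norm e \<le> C" "0 \<le> C"
  using c_ge_3 mult_right_mono[OF c_ge_3, of "norm e"] by (simp_all add: C_def mult.commute)

lemma n_bounds: "n\<^sup>2 = (norm (X t))\<^sup>2 + (norm (Y t))\<^sup>2 + 1" "norm (X t) \<le> n" "norm (Y t) \<le> n" "1 \<le> n"
  unfolding n_def by (auto intro!: real_le_rsqrt)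

lemma norm_X': "norm (e * piv_x \<theta> (Z t) (X t) (Y t)) \<le> C * (norm (X t) * n + 1)"
  using mult_left_mono[OF norm_piv_x_le[OF L n_bounds(2-4)], of "norm e" \<theta> \<kappa>]
  by (simp add: norm_mult C_def c_def mult.assoc)

lemma norm_Y': "norm (e * piv_y \<kappa> (Z t) (X t) (Y t)) \<le> C * (norm (Y t) * n + 1)"
  using mult_left_mono[OF norm_piv_y_le[OF L n_bounds(2-4)], of "norm e" \<kappa> \<theta>]
  by (simp add: norm_mult C_def c_def mult.assoc)

lemma H': "((\<lambda>t. piv_H \<theta> \<kappa> (Z t) (X t) (Y t)) has_vector_derivative e * (2 * X t * Y t)) (at t within S)"
  unfolding piv_H_def
  by (rule derivative_eq_intros X Y Z refl)+ (simp add: piv_x_def piv_y_def algebra_simps power2_eq_square)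

lemma N': obtains N' where
  "((\<lambda>t. (norm (X t))\<^sup>2 + (norm (Y t))\<^sup>2 + 1) has_real_derivative N') (at t within S)" "\<bar>N'\<bar> \<le> 6 * C * n ^ 3"
proof
  let ?X' = "e * piv_x \<theta> (Z t) (X t) (Y t)" and ?Y' = "e * piv_y \<kappa> (Z t) (X t) (Y t)"
  show "((\<lambda>t. (norm (X t))\<^sup>2 + (norm (Y t))\<^sup>2 + 1) has_real_derivative
     2 * (X t \<bullet> ?X') + 2 * (Y t \<bullet> ?Y') + 0) (at t within S)"
    by (intro DERIV_add DERIV_const has_real_derivative_norm_power2 X Y)
  have "\<bar>X t \<bullet> ?X'\<bar> \<le> norm (X t) * (C * (norm (X t) * n + 1))"
    using Cauchy_Schwarz_ineq2[of "X t" ?X'] mult_left_mono[OF norm_X', of "norm (X t)"] by simp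
  moreover have "\<bar>Y t \<bullet> ?Y'\<bar> \<le> norm (Y t) * (C * (norm (Y t) * n + 1))"
    using Cauchy_Schwarz_ineq2[of "Y t" ?Y'] mult_left_mono[OF norm_Y', of "norm (Y t)"] by simp
  moreover have "2 * (norm (X t) * (C * (norm (X t) * n + 1))) + 2 * (norm (Y t) * (C * (norm (Y t) * n + 1)))
    \<le> 6 * C * n ^ 3"
  proof -
    have "n * 1 \<le> n * n\<^sup>2"
      using n_bounds(4) by (intro mult_left_mono) (auto simp: one_le_power)
    then have "n \<le> n ^ 3" by (simp add: power3_eq_cube power2_eq_square)
    have "(norm (X t))\<^sup>2 + (norm (Y t))\<^sup>2 \<le> n\<^sup>2" using n_bounds(1) by simp
    from mult_right_mono[OF this, of n]
    have "(norm (X t))\<^sup>2 * n + (norm (Y t))\<^sup>2 * n \<le> n ^ 3"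
      using n_bounds(4) by (simp add: algebra_simps power3_eq_cube power2_eq_square)
    then have "2 * ((norm (X t))\<^sup>2 * n + (norm (Y t))\<^sup>2 * n + norm (X t) + norm (Y t)) \<le> 6 * n ^ 3"
      using n_bounds(2,3) \<open>n \<le> n ^ 3\<close> by simp
    from mult_left_mono[OF this C_ge(2)] show ?thesis
      by (simp add: algebra_simps power2_eq_square)
  qed
  ultimately show "\<bar>2 * (X t \<bullet> ?X') + 2 * (Y t \<bullet> ?Y') + 0\<bar> \<le> 6 * C * n ^ 3" by linarith
qed

text \<open>Up to constants the numerator of \<open>piv_corr\<close> is at most
  \<open>norm (x * y) * n\<close>, and its derivative at most
  \<open>n\<^sup>2 * (norm (x * y) + 1)\<close>. Against the denominator \<open>n\<^sup>2\<close>,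
  whose derivative has order \<open>n ^ 3\<close>, all powers of \<open>n\<close> cancel.\<close>

lemma V'_product_bound:
  obtains D where "((\<lambda>t. piv_V \<theta> \<kappa> (Z t) (X t) (Y t)) has_vector_derivative D) (at t within S)"
    "norm D \<le> 45 * C * (1 + norm (X t) * norm (Y t))"
proof -
  let ?X' = "e * piv_x \<theta> (Z t) (X t) (Y t)" and ?Y' = "e * piv_y \<kappa> (Z t) (X t) (Y t)"
  let ?a = "norm (X t)" and ?b = "norm (Y t)"
  obtain N' where N': "((\<lambda>t. (norm (X t))\<^sup>2 + (norm (Y t))\<^sup>2 + 1) has_real_derivative N') (at t within S)"
    "\<bar>N'\<bar> \<le> 6 * C * n ^ 3" using N' by blast
  define A where "A t = 2 *\<^sub>R ((norm (X t))\<^sup>2 *\<^sub>R Y t + (norm (Y t))\<^sup>2 *\<^sub>R X t)" for t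
  define A' where "A' = 2 *\<^sub>R ((?a\<^sup>2 *\<^sub>R ?Y' + (2 * (X t \<bullet> ?X')) *\<^sub>R Y t) + (?b\<^sup>2 *\<^sub>R ?X' + (2 * (Y t \<bullet> ?Y')) *\<^sub>R X t))"
  have A: "(A has_vector_derivative A') (at t within S)"
    unfolding A_def A'_def scaleR_add_right[of 2]
    using has_vector_derivative_scaleR[OF DERIV_const[of 2] has_vector_derivative_add[OF
        has_vector_derivative_scaleR[OF has_real_derivative_norm_power2[OF X] Y]
        has_vector_derivative_scaleR[OF has_real_derivative_norm_power2[OF Y] X]]]
    by (simp add: scaleR_add_right)
  have ab: "?a * ?b \<ge> 0" "?a \<le> n" "?b \<le> n" "?a \<ge> 0" "?b \<ge> 0" "n \<ge> 1" using n_bounds by auto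
  have An: "norm (A t) \<le> 4 * (?a * ?b) * n"
  proof -
    have "norm (A t) \<le> 2 * (?a\<^sup>2 * ?b + ?b\<^sup>2 * ?a)"
      using norm_triangle_ineq[of "?a\<^sup>2 *\<^sub>R Y t" "?b\<^sup>2 *\<^sub>R X t"] by (simp add: A_def)
    also have "\<dots> = 2 * ((?a * ?b) * (?a + ?b))" by (simp add: power2_eq_square algebra_simps)
    also have "\<dots> \<le> 2 * ((?a * ?b) * (2 * n))"
      using ab by (intro mult_left_mono) auto
    finally show ?thesis by simp
  qed
  have A'n: "norm A' \<le> 2 * C * n\<^sup>2 * (10 * (?a * ?b) + 1)"
  proof -
    have x: "\<bar>X t \<bullet> ?X'\<bar> \<le> ?a * (C * (?a * n + 1))"
      using Cauchy_Schwarz_ineq2[of "X t" ?X'] mult_left_mono[OF norm_X', of "norm (X t)"] by simp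
    have y: "\<bar>Y t \<bullet> ?Y'\<bar> \<le> ?b * (C * (?b * n + 1))"
      using Cauchy_Schwarz_ineq2[of "Y t" ?Y'] mult_left_mono[OF norm_Y', of "norm (Y t)"] by simp
    have "norm A' \<le> 2 * ((?a\<^sup>2 * norm ?Y' + 2 * \<bar>X t \<bullet> ?X'\<bar> * ?b) + (?b\<^sup>2 * norm ?X' + 2 * \<bar>Y t \<bullet> ?Y'\<bar> * ?a))"
      unfolding A'_def norm_scaleR
      by (intro mult_mono norm_triangle_mono) (auto simp: norm_mult abs_mult)
    also have "\<dots> \<le> 2 * ((?a\<^sup>2 * (C * (?b * n + 1)) + 2 * (?a * (C * (?a * n + 1))) * ?b) +
        (?b\<^sup>2 * (C * (?a * n + 1)) + 2 * (?b * (C * (?b * n + 1))) * ?a))"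
      using x y norm_X' norm_Y' by (intro mult_left_mono add_mono mult_right_mono) auto
    also have "\<dots> = 2 * C * (3 * (?a * ?b) * (n * (?a + ?b)) + 4 * (?a * ?b) + (?a\<^sup>2 + ?b\<^sup>2))"
      by (simp add: power2_eq_square algebra_simps)
    also have "\<dots> \<le> 2 * C * (3 * (?a * ?b) * (2 * n\<^sup>2) + 4 * (?a * ?b) * n\<^sup>2 + n\<^sup>2)"
    proof -
      have "n * (?a + ?b) \<le> n * (2 * n)" using ab by (intro mult_left_mono) auto
      then have 1: "3 * (?a * ?b) * (n * (?a + ?b)) \<le> 3 * (?a * ?b) * (2 * n\<^sup>2)"
        using ab by (intro mult_left_mono) (auto simp: power2_eq_square)
      have 2: "4 * (?a * ?b) * 1 \<le> 4 * (?a * ?b) * n\<^sup>2"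
        using ab by (intro mult_left_mono) (auto simp: one_le_power)
      have 3: "?a\<^sup>2 + ?b\<^sup>2 \<le> n\<^sup>2" using n_bounds(1) by simp
      show ?thesis
        using mult_left_mono[OF add_mono[OF add_mono[OF 1 2] 3], of "2 * C"] C_ge(2) by simp
    qed
    also have "\<dots> = 2 * C * n\<^sup>2 * (10 * (?a * ?b) + 1)" by (simp add: algebra_simps)
    finally show ?thesis .
  qed
  obtain D where D: "((\<lambda>t. A t /\<^sub>R ((norm (X t))\<^sup>2 + (norm (Y t))\<^sup>2 + 1)) has_vector_derivative D) (at t within S)"
    "norm D \<le> 2 * C * n\<^sup>2 * (10 * (?a * ?b) + 1) / n\<^sup>2 + 6 * C * n ^ 3 * (4 * (?a * ?b) * n) / n ^ 4"
    using has_vector_derivative_quotient_bound[OF N'(1) A n_bounds(1)[symmetric] n_bounds(4) N'(2) An A'n] by blast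
  have "n ^ 3 * n = n ^ 4" by (simp add: eval_nat_numeral)
  then have "6 * C * n ^ 3 * (4 * (?a * ?b) * n) / n ^ 4 = 24 * C * (?a * ?b)"
    using n_bounds(4) by (simp add: field_simps)
  then have D2: "norm D \<le> 2 * C * (10 * (?a * ?b) + 1) + 24 * C * (?a * ?b)"
    using D(2) n_bounds(4) by (simp add: mult_ac)
  show thesis
  proof (rule that)
    show "((\<lambda>t. piv_V \<theta> \<kappa> (Z t) (X t) (Y t)) has_vector_derivative e * (2 * X t * Y t) - D) (at t within S)"
      using has_vector_derivative_diff[OF H' D(1)] by (simp add: piv_V_def piv_corr_def A_def)
    have "norm (e * (2 * X t * Y t) - D) \<le> 2 * (norm e * (?a * ?b)) + norm D"
      by (rule order_trans[OF norm_triangle_ineq4]) (simp add: norm_mult)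
    also have "norm e * (?a * ?b) \<le> C / 3 * (?a * ?b)"
      using C_ge(1) by (intro mult_right_mono) auto
    finally have "norm (e * (2 * X t * Y t) - D) \<le> 2 / 3 * (C * (?a * ?b)) + norm D" by simp
    moreover have "norm D \<le> 44 * (C * (?a * ?b)) + 2 * C"
      using D2 by (simp add: algebra_simps)
    moreover have "45 * C * (1 + ?a * ?b) = 45 * C + 45 * (C * (?a * ?b))"
      by (simp add: algebra_simps)
    \<comment> \<open>45 rounds up 20 + 24 from the correction plus 2/3 from \<open>H'\<close>,
      where \<open>norm e \<le> C / 3\<close>.\<close>
    ultimately show "norm (e * (2 * X t * Y t) - D) \<le> 45 * C * (1 + ?a * ?b)"
      using C_ge(2) mult_nonneg_nonneg[OF C_ge(2) ab(1)] by linarith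
  qed
qed

text \<open>
  Near \<open>d = 0\<close> \<open>x * y\<close> is not controlled by \<open>V\<close>; there one uses that \<open>2 * x * y - (x + y)'\<close> is the
  quadratic \<open>(x - y) * (x - y - 2 * z) + 2 * (\<theta> + \<kappa>)\<close> in the bounded quantity \<open>x - y\<close>.
\<close>

lemma V'_difference_bound:
  obtains D where "((\<lambda>t. piv_V \<theta> \<kappa> (Z t) (X t) (Y t)) has_vector_derivative D) (at t within S)"
    "norm D \<le> 45 * C * (1 + (norm (X t - Y t))\<^sup>2)"
proof -
  let ?X' = "e * piv_x \<theta> (Z t) (X t) (Y t)" and ?Y' = "e * piv_y \<kappa> (Z t) (X t) (Y t)"
  let ?a = "norm (X t)" and ?b = "norm (Y t)"
  define q where "q = norm (X t - Y t)"
  have q: "q \<ge> 0" by (simp add: q_def)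
  obtain N' where N': "((\<lambda>t. (norm (X t))\<^sup>2 + (norm (Y t))\<^sup>2 + 1) has_real_derivative N') (at t within S)"
    "\<bar>N'\<bar> \<le> 6 * C * n ^ 3" using N' by blast
  \<comment> \<open>By \<open>piv_corr_alt\<close>, \<open>V\<close> is \<open>H - (x + y)\<close>
    plus \<open>R\<close> over the denominator.\<close>
  define R where "R t = ((X t - Y t) \<bullet> (X t + Y t)) *\<^sub>R (X t - Y t) + (X t + Y t)" for t
  define I' where "I' = (X t - Y t) \<bullet> (?X' + ?Y') + (?X' - ?Y') \<bullet> (X t + Y t)"
  define R' where "R' = (((X t - Y t) \<bullet> (X t + Y t)) *\<^sub>R (?X' - ?Y') + I' *\<^sub>R (X t - Y t)) + (?X' + ?Y')"
  have s: "((\<lambda>t. X t + Y t) has_vector_derivative ?X' + ?Y') (at t within S)"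
    and d: "((\<lambda>t. X t - Y t) has_vector_derivative ?X' - ?Y') (at t within S)"
    using X Y by (auto intro: has_vector_derivative_add has_vector_derivative_diff)
  have "((\<lambda>t. (X t - Y t) \<bullet> (X t + Y t)) has_real_derivative I') (at t within S)"
    using has_derivative_inner[OF d[unfolded has_vector_derivative_def] s[unfolded has_vector_derivative_def]]
    unfolding has_field_derivative_def I'_def
    by (rule has_derivative_eq_rhs) (auto simp: fun_eq_iff algebra_simps)
  from has_vector_derivative_add[OF has_vector_derivative_scaleR[OF this d] s]
  have R: "(R has_vector_derivative R') (at t within S)"
    unfolding R_def R'_def .
  have n: "?a \<le> n" "?b \<le> n" "?a \<ge> 0" "?b \<ge> 0" "n \<ge> 1" using n_bounds by auto
  have sn: "norm (X t + Y t) \<le> 2 * n"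
    using norm_triangle_ineq[of "X t" "Y t"] n by simp
  have i: "\<bar>(X t - Y t) \<bullet> (X t + Y t)\<bar> \<le> q * (2 * n)"
    using Cauchy_Schwarz_ineq2[of "X t - Y t" "X t + Y t"] mult_left_mono[OF sn q] by (simp add: q_def)
  have s': "norm (?X' + ?Y') \<le> 4 * C * n\<^sup>2"
  proof -
    have *: "u * n + 1 \<le> 2 * n\<^sup>2" if "u \<le> n" for u
      using mult_right_mono[OF that order_trans[OF zero_le_one n(5)]] one_le_power[OF n(5), of 2] by (simp add: power2_eq_square)
    have "norm (?X' + ?Y') \<le> C * (?a * n + 1) + C * (?b * n + 1)"
      by (intro norm_triangle_mono norm_X' norm_Y')
    also have "\<dots> \<le> C * (2 * n\<^sup>2) + C * (2 * n\<^sup>2)"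
      using C_ge(2) * n by (intro add_mono mult_left_mono) auto
    finally show ?thesis by (simp add: algebra_simps)
  qed
  \<comment> \<open>The difference of the two equations contains \<open>x + y\<close> only to the
    first power, next to a factor in \<open>x - y\<close> and \<open>z\<close>. Hence the order
    \<open>n * (q + 1)\<close> rather than \<open>n\<^sup>2\<close>.\<close>
  have d': "norm (?X' - ?Y') \<le> 2 * C * n * (q + 1)"
  proof -
    have "piv_x \<theta> (Z t) (X t) (Y t) - piv_y \<kappa> (Z t) (X t) (Y t) =
      (X t + Y t) * (2 * Z t - (X t - Y t)) + 2 * (\<kappa> - \<theta>)"
      by (simp add: piv_x_def piv_y_def algebra_simps power2_eq_square)
    also have "norm \<dots> \<le> (2 * n) * (2 * L + q) + 2 * (norm \<kappa> + norm \<theta>)"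
    proof (rule norm_triangle_mono)
      have "norm (2 * Z t - (X t - Y t)) \<le> 2 * L + q"
        using norm_triangle_ineq4[of "2 * Z t" "X t - Y t"] L by (simp add: q_def norm_mult)
      then show "norm ((X t + Y t) * (2 * Z t - (X t - Y t))) \<le> (2 * n) * (2 * L + q)"
        unfolding norm_mult using sn n(5) by (intro mult_mono) auto
      show "norm (2 * (\<kappa> - \<theta>)) \<le> 2 * (norm \<kappa> + norm \<theta>)"
        using norm_triangle_ineq4[of \<kappa> \<theta>] unfolding norm_mult by simp
    qed
    also have "\<dots> \<le> 2 * n * (2 * L + q) + 2 * n * (norm \<kappa> + norm \<theta>)"
      using mult_right_mono[of 1 n "2 * (norm \<kappa> + norm \<theta>)"] n(5) by (simp add: algebra_simps)
    also have "\<dots> \<le> 2 * n * (c * (q + 1))"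
    proof -
      have "2 * L + q + (norm \<kappa> + norm \<theta>) \<le> c * 1 + 1 * q"
        using L_ge_0 by (simp add: c_def)
      also have "\<dots> \<le> c * 1 + c * q" using c_ge_3 q by (intro add_mono mult_right_mono) auto
      finally have "2 * n * (2 * L + q + (norm \<kappa> + norm \<theta>)) \<le> 2 * n * (c * 1 + c * q)"
        using n(5) by (intro mult_left_mono) auto
      then show ?thesis by (simp add: algebra_simps)
    qed
    finally have "norm e * norm (piv_x \<theta> (Z t) (X t) (Y t) - piv_y \<kappa> (Z t) (X t) (Y t)) \<le> norm e * (2 * n * (c * (q + 1)))"
      by (intro mult_left_mono) auto
    then show ?thesis by (simp add: C_def norm_mult mult_ac flip: right_diff_distrib)
  qed
  have I': "\<bar>I'\<bar> \<le> 4 * C * n\<^sup>2 * (2 * q + 1)"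
  proof -
    have "\<bar>(X t - Y t) \<bullet> (?X' + ?Y')\<bar> \<le> q * (4 * C * n\<^sup>2)"
      using Cauchy_Schwarz_ineq2[of "X t - Y t" "?X' + ?Y'"] mult_left_mono[OF s' q] by (simp add: q_def)
    moreover have "\<bar>(?X' - ?Y') \<bullet> (X t + Y t)\<bar> \<le> (2 * C * n * (q + 1)) * (2 * n)"
      using Cauchy_Schwarz_ineq2[of "?X' - ?Y'" "X t + Y t"] mult_mono[OF d' sn] C_ge q n by fastforce
    ultimately show ?thesis
      unfolding I'_def by (simp add: algebra_simps power2_eq_square)
  qed
  have Rn: "norm (R t) \<le> 2 * n * (1 + q\<^sup>2)"
  proof -
    have "norm (R t) \<le> q * (2 * n) * q + 2 * n"
      unfolding R_def using i sn q by (intro norm_triangle_mono) (auto simp: q_def intro: mult_right_mono)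
    then show ?thesis by (simp add: algebra_simps power2_eq_square)
  qed
  have R'n: "norm R' \<le> 16 * C * n\<^sup>2 * (1 + q\<^sup>2)"
  proof -
    have "norm R' \<le> (q * (2 * n)) * (2 * C * n * (q + 1)) + (4 * C * n\<^sup>2 * (2 * q + 1)) * q + 4 * C * n\<^sup>2"
      unfolding R'_def
      by (intro norm_triangle_mono s'; unfold norm_scaleR; intro mult_mono)
        (use i d' I' q n C_ge(2) in \<open>auto simp: q_def\<close>)
    also have "\<dots> = 4 * C * n\<^sup>2 * (3 * q\<^sup>2 + 2 * q + 1)"
      by (simp add: algebra_simps power2_eq_square)
    also have "\<dots> \<le> 4 * C * n\<^sup>2 * (4 * (1 + q\<^sup>2))"
    proof (intro mult_left_mono)
      have "0 \<le> (q - 1)\<^sup>2" by simp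
      then show "3 * q\<^sup>2 + 2 * q + 1 \<le> 4 * (1 + q\<^sup>2)"
        by (simp add: power2_eq_square algebra_simps)
    qed (use C_ge(2) in auto)
    finally show ?thesis by (simp add: algebra_simps)
  qed
  obtain D where D: "((\<lambda>t. R t /\<^sub>R ((norm (X t))\<^sup>2 + (norm (Y t))\<^sup>2 + 1)) has_vector_derivative D) (at t within S)"
    "norm D \<le> 16 * C * n\<^sup>2 * (1 + q\<^sup>2) / n\<^sup>2 + 6 * C * n ^ 3 * (2 * n * (1 + q\<^sup>2)) / n ^ 4"
    using has_vector_derivative_quotient_bound[OF N'(1) R n_bounds(1)[symmetric] n_bounds(4) N'(2) Rn R'n] by blast
  have "n ^ 3 * n = n ^ 4" by (simp add: eval_nat_numeral)
  then have e2: "6 * C * n ^ 3 * (2 * n * (1 + q\<^sup>2)) / n ^ 4 = 12 * C * (1 + q\<^sup>2)"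
    using n(5) by (simp add: field_simps)
  have e1: "16 * C * n\<^sup>2 * (1 + q\<^sup>2) / n\<^sup>2 = 16 * C * (1 + q\<^sup>2)" using n(5) by simp
  have D2: "norm D \<le> 28 * C * (1 + q\<^sup>2)"
    using D(2) unfolding e1 e2 by (simp add: algebra_simps)
  show thesis
  proof (rule that)
    show "((\<lambda>t. piv_V \<theta> \<kappa> (Z t) (X t) (Y t)) has_vector_derivative e * (2 * X t * Y t) - ((?X' + ?Y') - D)) (at t within S)"
      using has_vector_derivative_diff[OF H' has_vector_derivative_diff[OF s D(1)]]
      by (simp add: piv_V_def piv_corr_alt R_def)
    have "e * (2 * X t * Y t) - ((?X' + ?Y') - D) = e * ((X t - Y t) * ((X t - Y t) - 2 * Z t) + 2 * (\<theta> + \<kappa>)) + D"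
      by (simp add: piv_x_def piv_y_def algebra_simps power2_eq_square)
    also have "norm \<dots> \<le> norm e * (c * (1 + q\<^sup>2)) + 28 * C * (1 + q\<^sup>2)"
    proof (intro norm_triangle_mono D2)
      have "norm ((X t - Y t) * ((X t - Y t) - 2 * Z t) + 2 * (\<theta> + \<kappa>)) \<le> q * (q + 2 * L) + 2 * (norm \<theta> + norm \<kappa>)"
      proof (rule norm_triangle_mono)
        have "norm ((X t - Y t) - 2 * Z t) \<le> q + 2 * L"
          using norm_triangle_ineq4[of "X t - Y t" "2 * Z t"] L by (simp add: q_def norm_mult)
        then show "norm ((X t - Y t) * ((X t - Y t) - 2 * Z t)) \<le> q * (q + 2 * L)"
          unfolding norm_mult using q by (intro mult_mono) (auto simp: q_def)
        show "norm (2 * (\<theta> + \<kappa>)) \<le> 2 * (norm \<theta> + norm \<kappa>)"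
          using norm_triangle_ineq[of \<theta> \<kappa>] unfolding norm_mult by simp
      qed
      also have "\<dots> \<le> c * (1 + q\<^sup>2)"
      proof -
        have "0 \<le> L * (q - 1)\<^sup>2" using L_ge_0 by simp
        moreover have "0 \<le> norm \<theta> * q\<^sup>2" "0 \<le> norm \<kappa> * q\<^sup>2" "0 \<le> L * q\<^sup>2" "0 \<le> q\<^sup>2"
          using L_ge_0 by auto
        moreover have "c * (1 + q\<^sup>2) = 3 + 2 * L + 2 * norm \<theta> + 2 * norm \<kappa> + 3 * q\<^sup>2 +
            2 * (L * q\<^sup>2) + 2 * (norm \<theta> * q\<^sup>2) + 2 * (norm \<kappa> * q\<^sup>2)"
          "q * (q + 2 * L) = q\<^sup>2 + 2 * (L * q)" "L * (q - 1)\<^sup>2 = L * q\<^sup>2 - 2 * (L * q) + L"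
          by (simp_all add: c_def power2_eq_square algebra_simps)
        ultimately show ?thesis using L_ge_0 norm_ge_zero[of \<theta>] norm_ge_zero[of \<kappa>]
          unfolding distrib_left[of 2] by linarith
      qed
      finally show "norm (e * ((X t - Y t) * ((X t - Y t) - 2 * Z t) + 2 * (\<theta> + \<kappa>))) \<le> norm e * (c * (1 + q\<^sup>2))"
        unfolding norm_mult by (intro mult_left_mono) auto
    qed
    also have "\<dots> = 29 * C * (1 + q\<^sup>2)" by (simp add: C_def algebra_simps)
    \<comment> \<open>Rounded up from 29 so that both bounds on the derivative share one factor and
      their minimum can be taken.\<close>
    also have "\<dots> \<le> 45 * C * (1 + q\<^sup>2)" using C_ge(2) by (intro mult_right_mono) auto
    finally show "norm (e * (2 * X t * Y t) - ((?X' + ?Y') - D)) \<le> 45 * C * (1 + (norm (X t - Y t))\<^sup>2)"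
      by (simp add: q_def)
  qed
qed

end

section \<open>Control by \<open>V\<close> near infinity and along segments\<close>

lemma norm_piv_H_plus_le:
  "norm (x * y * (x - y - 2 * z)) \<le> norm (piv_V \<theta> \<kappa> z x y) + (2 * norm \<theta> + 2 * norm \<kappa> + 4) * max (norm x) (norm y)"
proof -
  let ?m = "max (norm x) (norm y)"
  have "x * y * (x - y - 2 * z) = - (piv_V \<theta> \<kappa> z x y + (2 * \<theta> * y - 2 * \<kappa> * x + piv_corr x y))"
    by (simp add: piv_V_def piv_H_def)
  also have "norm \<dots> \<le> norm (piv_V \<theta> \<kappa> z x y) + norm (2 * \<theta> * y - 2 * \<kappa> * x + piv_corr x y)"
    unfolding norm_minus_cancel by (rule norm_triangle_ineq)
  also have "norm (2 * \<theta> * y - 2 * \<kappa> * x + piv_corr x y) \<le> (2 * norm \<theta> * norm y + 2 * norm \<kappa> * norm x) + 2 * (norm x + norm y)"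
    using norm_triangle_ineq4[of "2 * \<theta> * y" "2 * \<kappa> * x"]
    by (intro norm_triangle_mono norm_piv_corr_le) (simp add: norm_mult)
  also have "\<dots> \<le> (2 * norm \<theta> * ?m + 2 * norm \<kappa> * ?m) + 2 * (?m + ?m)"
    by (intro add_mono mult_left_mono) auto
  finally show ?thesis by (simp add: algebra_simps)
qed

text \<open>\<open>V\<close> differs from the cubic \<open>- (x * y * d)\<close> by terms linear in
  the larger modulus \<open>m\<close>. As \<open>x - y - d = 2 * z\<close> is bounded, at most one
  of the three factors is small compared with a large \<open>m\<close>; dividing by a large factor
  bounds the product of the other two. The alternatives are the bounded region and the surroundings
  of \<open>y = 0\<close>, \<open>d = 0\<close> and \<open>x = 0\<close>, in this order.\<close>

lemma piv_regions:
  assumes "0 \<le> L"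
  obtains C where "1 \<le> C"
    "\<And>z x y. norm z \<le> L \<Longrightarrow>
       (norm x \<le> C \<and> norm y \<le> C) \<or>
       (1 \<le> norm x \<and> norm (x * y) \<le> C * (1 + norm (piv_V \<theta> \<kappa> z x y))) \<or>
       (1 \<le> norm y \<and> norm (x - y - 2 * z) \<le> C * norm y \<and>
          norm (y * (x - y - 2 * z)) \<le> C * (1 + norm (piv_V \<theta> \<kappa> z x y))) \<or>
       (1 \<le> norm y \<and> 1 \<le> norm (x - y - 2 * z) \<and> norm (x - y - 2 * z) \<le> C * norm y \<and>
          norm (x * y) \<le> C * (1 + norm (piv_V \<theta> \<kappa> z x y)))"
proof
  define k where "k = 2 * norm \<theta> + 2 * norm \<kappa> + 4"
  define C where "C = 8 * L + 4 * k + 6"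
  have k: "k \<ge> 4" by (simp add: k_def)
  show C1: "1 \<le> C" using assms k by (simp add: C_def)
  fix z x y :: complex
  assume z: "norm z \<le> L"
  define v a b d m where "v = norm (piv_V \<theta> \<kappa> z x y)" and "a = norm x" and "b = norm y"
    and "d = norm (x - y - 2 * z)" and "m = max a b"
  have nn: "v \<ge> 0" "a \<ge> 0" "b \<ge> 0" "d \<ge> 0" by (simp_all add: v_def a_def b_def d_def)
  have main: "a * b * d \<le> v + k * m"
    using norm_piv_H_plus_le[of x y z \<theta> \<kappa>] by (simp add: v_def a_def b_def d_def m_def k_def norm_mult)
  have z2: "norm (2 * z) \<le> 2 * L" using z by (simp add: norm_mult)
  have d_le: "d \<le> a + b + 2 * L"
    using norm_triangle_ineq4[of "x - y" "2 * z"] norm_triangle_ineq4[of x y] z2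
    by (simp add: a_def b_def d_def)
  have d_ge: "d \<ge> a - b - 2 * L" "d \<ge> b - a - 2 * L"
    using norm_triangle_ineq2[of "x - y" "2 * z"] norm_triangle_ineq3[of x y] z2
    unfolding a_def b_def d_def by linarith+
  have fin: "u \<le> C * (1 + v)" if "u \<le> v + 4 * k" for u
  proof -
    have "u \<le> C * 1 + 1 * v" using that assms by (simp add: C_def)
    also have "\<dots> \<le> C * 1 + C * v" using C1 nn by (intro add_mono mult_right_mono) auto
    finally show ?thesis by (simp add: algebra_simps)
  qed
  \<comment> \<open>The threshold on \<open>m\<close> does two things: \<open>2 * L < m / 4\<close>
    yields \<open>d \<ge> m / 4\<close> when \<open>a\<close> or \<open>b\<close> is at most
    \<open>m / 2\<close>, and \<open>m > 4\<close> absorbs the factor in front of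
    \<open>v\<close>.\<close>
  have off_diagonal: "a * b \<le> C * (1 + v)" if m: "m > 8 * L + 4" and d: "d \<ge> m / 4"
  proof (rule fin)
    have "a * b * (m / 4) \<le> a * b * d" using d nn by (intro mult_left_mono) auto
    then have "m * (a * b) \<le> 4 * v + 4 * (k * m)" using main by (simp add: algebra_simps)
    also have "4 * v \<le> m * v" using m assms nn by (intro mult_right_mono) auto
    finally have "m * (a * b) \<le> m * (v + 4 * k)" by (simp add: algebra_simps)
    then show "a * b \<le> v + 4 * k"
      by (rule mult_left_le_imp_le) (use m assms in linarith)
  qed
  have "m = a \<or> m = b" by (simp add: m_def max_def)
  then consider "m \<le> 8 * L + 4" | "m > 8 * L + 4" "m = a" "b \<le> m / 2" | "m > 8 * L + 4" "m = b" "a \<le> m / 2"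
    | "m > 8 * L + 4" "a \<ge> m / 2" "b \<ge> m / 2"
    using assms nn by argo
  then have "(a \<le> C \<and> b \<le> C) \<or> (1 \<le> a \<and> a * b \<le> C * (1 + v)) \<or>
    (1 \<le> b \<and> d \<le> C * b \<and> b * d \<le> C * (1 + v)) \<or> (1 \<le> b \<and> 1 \<le> d \<and> d \<le> C * b \<and> a * b \<le> C * (1 + v))"
  proof cases
    case 1
    then have "a \<le> C" "b \<le> C" using k by (simp_all add: C_def m_def)
    then show ?thesis by blast
  next
    case 2
    then have "d \<ge> m / 4" using d_ge by linarith
    from off_diagonal[OF 2(1) this] show ?thesis using 2 assms by linarith
  next
    case 3
    then have d: "d \<ge> m / 4" using d_ge by linarith
    have "d \<le> 6 * b" using d_le 3 assms by linarith
    also have "\<dots> \<le> C * b" using assms k nn by (intro mult_right_mono) (auto simp: C_def)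
    finally have "d \<le> C * b" .
    moreover have "1 \<le> b" "1 \<le> d" using 3 d assms by linarith+
    ultimately show ?thesis using off_diagonal[OF 3(1) d] by blast
  next
    case 4
    have ab: "a \<le> m" "b \<le> m" by (simp_all add: m_def)
    have "d \<le> 6 * b" using d_le 4 assms ab by linarith
    also have "\<dots> \<le> C * b" using assms k nn by (intro mult_right_mono) (auto simp: C_def)
    finally have db: "d \<le> C * b" .
    have "(m / 2) * b * d \<le> a * b * d" using 4 nn by (intro mult_right_mono) auto
    then have "m * (b * d) \<le> 2 * v + 2 * (k * m)" using main by (simp add: algebra_simps)
    also have "2 * v \<le> m * v" using 4 assms nn by (intro mult_right_mono) auto
    also have "2 * (k * m) \<le> m * (4 * k)" using 4(1) assms k by simp
    finally have "m * (b * d) \<le> m * (v + 4 * k)" by (simp add: algebra_simps)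
    then have "b * d \<le> v + 4 * k" by (rule mult_left_le_imp_le) (use 4(1) assms in linarith)
    moreover have "1 \<le> b" using 4 assms by linarith
    ultimately show ?thesis using fin db by blast
  qed
  then show "(norm x \<le> C \<and> norm y \<le> C) \<or>
       (1 \<le> norm x \<and> norm (x * y) \<le> C * (1 + norm (piv_V \<theta> \<kappa> z x y))) \<or>
       (1 \<le> norm y \<and> norm (x - y - 2 * z) \<le> C * norm y \<and>
          norm (y * (x - y - 2 * z)) \<le> C * (1 + norm (piv_V \<theta> \<kappa> z x y))) \<or>
       (1 \<le> norm y \<and> 1 \<le> norm (x - y - 2 * z) \<and> norm (x - y - 2 * z) \<le> C * norm y \<and>
          norm (x * y) \<le> C * (1 + norm (piv_V \<theta> \<kappa> z x y)))"
    by (simp add: norm_mult v_def a_def b_def d_def)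
qed

text \<open>The product is controlled by \<open>V\<close> except near \<open>d = 0\<close>, and
  there the squared difference is. With the minimum, a path may cross regions without a case
  distinction.\<close>

lemma piv_min_bound:
  assumes "0 \<le> L"
  obtains C where "1 \<le> C"
    "\<And>z x y. norm z \<le> L \<Longrightarrow>
       1 + min (norm x * norm y) ((norm (x - y))\<^sup>2) \<le> C * (1 + norm (piv_V \<theta> \<kappa> z x y))"
proof -
  obtain C where C: "1 \<le> C" and reg: "\<And>z x y. norm z \<le> L \<Longrightarrow>
       (norm x \<le> C \<and> norm y \<le> C) \<or>
       (1 \<le> norm x \<and> norm (x * y) \<le> C * (1 + norm (piv_V \<theta> \<kappa> z x y))) \<or>
       (1 \<le> norm y \<and> norm (x - y - 2 * z) \<le> C * norm y \<and>
          norm (y * (x - y - 2 * z)) \<le> C * (1 + norm (piv_V \<theta> \<kappa> z x y))) \<or>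
       (1 \<le> norm y \<and> 1 \<le> norm (x - y - 2 * z) \<and> norm (x - y - 2 * z) \<le> C * norm y \<and>
          norm (x * y) \<le> C * (1 + norm (piv_V \<theta> \<kappa> z x y)))"
    using piv_regions[OF assms, of \<theta> \<kappa>] by metis
  show thesis
  proof (rule that)
    let ?K = "1 + 2 * C\<^sup>2 + 8 * L\<^sup>2"
    show "1 \<le> ?K" by simp
    fix z x y :: complex
    assume z: "norm z \<le> L"
    define v where "v = norm (piv_V \<theta> \<kappa> z x y)"
    have v: "v \<ge> 0" by (simp add: v_def)
    have CC: "C \<le> C\<^sup>2" using C mult_left_mono[of 1 C C] by (simp add: power2_eq_square)
    have K: "1 + C * (1 + v) \<le> ?K * (1 + v)"
    proof -
      have "1 + C * (1 + v) \<le> (1 + C) * (1 + v)" using v by (simp add: algebra_simps)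
      also have "\<dots> \<le> ?K * (1 + v)" using CC C v zero_le_power2[of L] by (intro mult_right_mono) linarith+
      finally show ?thesis .
    qed
    have K2: "u \<le> ?K * (1 + v)" if "u \<le> ?K" for u
    proof -
      have "?K * 1 \<le> ?K * (1 + v)" using v by (intro mult_left_mono) auto
      then have "?K \<le> ?K * (1 + v)" unfolding mult_1_right .
      with that show ?thesis by (rule order_trans)
    qed
    consider "norm x \<le> C" "norm y \<le> C" | "norm (x * y) \<le> C * (1 + v)" |
      "norm (x - y - 2 * z) \<le> C * norm y" "norm (y * (x - y - 2 * z)) \<le> C * (1 + v)"
      using reg[OF z, of x y] unfolding v_def by blast
    then have "1 + norm x * norm y \<le> ?K * (1 + v) \<or> 1 + (norm (x - y))\<^sup>2 \<le> ?K * (1 + v)"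
    proof cases
      case 1
      then have "norm x * norm y \<le> C * C" using C by (intro mult_mono) auto
      then have "1 + norm x * norm y \<le> ?K"
        using zero_le_power2[of L] zero_le_power2[of C] unfolding power2_eq_square[symmetric] by linarith
      then show ?thesis using K2 by blast
    next
      case 2
      then show ?thesis using K by (simp add: norm_mult)
    next
      case 3
      define d where "d = norm (x - y - 2 * z)"
      have "norm (x - y) \<le> d + 2 * L"
        using norm_triangle_ineq[of "x - y - 2 * z" "2 * z"] z by (simp add: d_def norm_mult)
      then have "(norm (x - y))\<^sup>2 \<le> (d + 2 * L)\<^sup>2" by (intro power_mono) auto
      also have "\<dots> \<le> 2 * d\<^sup>2 + 8 * L\<^sup>2"
        using zero_le_power2[of "d - 2 * L"] by (simp add: power2_eq_square algebra_simps)
      \<comment> \<open>\<open>V\<close> controls only \<open>norm y * d\<close>; the comparison of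
        \<open>d\<close> with \<open>norm y\<close> in this region trades one factor
        \<open>d\<close> for \<open>norm y\<close>.\<close>
      also have "d\<^sup>2 \<le> C * (norm y * d)"
        using mult_right_mono[OF 3(1), of d] by (simp add: d_def power2_eq_square mult.assoc)
      also have "\<dots> \<le> C * (C * (1 + v))"
        using 3(2) C by (intro mult_left_mono) (auto simp: d_def norm_mult)
      finally have "1 + (norm (x - y))\<^sup>2 \<le> (1 + 8 * L\<^sup>2) * 1 + 2 * C\<^sup>2 * (1 + v)"
        by (simp add: power2_eq_square)
      also have "\<dots> \<le> (1 + 8 * L\<^sup>2) * (1 + v) + 2 * C\<^sup>2 * (1 + v)"
        using v by (intro add_mono mult_left_mono) auto
      also have "\<dots> = ?K * (1 + v)" by (simp add: algebra_simps)
      finally show ?thesis by blast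
    qed
    then show "1 + min (norm x * norm y) ((norm (x - y))\<^sup>2) \<le> ?K * (1 + norm (piv_V \<theta> \<kappa> z x y))"
      unfolding v_def by linarith
  qed
qed

text \<open>The squared modulus is differentiable also at zeros of \<open>v\<close>, where the
  modulus may fail to be. The exponent comes from
  \<open>2 * u * (1 + u) \<le> 3 * (1 + u\<^sup>2)\<close>.\<close>

lemma complex_gronwall:
  fixes v :: "real \<Rightarrow> complex"
  assumes v: "\<And>t. 0 \<le> t \<Longrightarrow> t \<le> 1 \<Longrightarrow> (v has_vector_derivative v' t) (at t)"
    and bound: "\<And>t. 0 \<le> t \<Longrightarrow> t \<le> 1 \<Longrightarrow> norm (v' t) \<le> C * (1 + norm (v t))"
  shows "norm (v 1) \<le> (1 + (norm (v 0))\<^sup>2) * exp (3 * C)"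
proof -
  have C: "0 \<le> C"
  proof -
    have "0 \<le> C * (1 + norm (v 0))" using bound[of 0] norm_ge_zero[of "v' 0"] by linarith
    moreover have "0 < 1 + norm (v 0)" by (simp add: add_pos_nonneg)
    ultimately show ?thesis by (simp add: zero_le_mult_iff)
  qed
  define W where "W t = (1 + (norm (v t))\<^sup>2) * exp (- (3 * C * t))" for t
  have "W 0 \<ge> W 1"
  proof (rule DERIV_nonpos_imp_nonincreasing[of 0 1 W])
    fix t :: real
    assume t: "0 \<le> t" "t \<le> 1"
    let ?D = "2 * (v t \<bullet> v' t)"
    have "((\<lambda>t. exp (- (3 * C * t))) has_real_derivative (- (3 * C)) * exp (- (3 * C * t))) (at t)"
      by (auto intro!: derivative_eq_intros)
    from DERIV_mult[OF DERIV_add[OF DERIV_const has_real_derivative_norm_power2[OF v[OF t]]] this]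
    have "(W has_real_derivative ?D * exp (- (3 * C * t)) + (- (3 * C)) * exp (- (3 * C * t)) * (1 + (norm (v t))\<^sup>2)) (at t)"
      unfolding W_def by simp
    moreover have "?D \<le> 3 * C * (1 + (norm (v t))\<^sup>2)"
    proof -
      define u where "u = norm (v t)"
      have "v t \<bullet> v' t \<le> u * (C * (1 + u))"
        using norm_cauchy_schwarz[of "v t" "v' t"] mult_left_mono[OF bound[OF t], of "norm (v t)"] by (simp add: u_def)
      moreover have "2 * (u * (C * (1 + u))) \<le> 3 * C * (1 + u\<^sup>2)"
      proof -
        have "2 * u * (1 + u) \<le> 3 * (1 + u\<^sup>2)"
          using zero_le_power2[of "u - 1"] by (simp add: power2_eq_square algebra_simps)
        from mult_left_mono[OF this C] show ?thesis by (simp add: algebra_simps)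
      qed
      ultimately show ?thesis unfolding u_def by linarith
    qed
    then have "(?D - 3 * C * (1 + (norm (v t))\<^sup>2)) * exp (- (3 * C * t)) \<le> 0"
      by (intro mult_nonpos_nonneg) auto
    ultimately show "\<exists>y. (W has_real_derivative y) (at t) \<and> y \<le> 0"
      by (intro exI conjI) (assumption, simp add: algebra_simps)
  qed simp
  then have "1 + (norm (v 1))\<^sup>2 \<le> (1 + (norm (v 0))\<^sup>2) * exp (3 * C)"
    by (simp add: W_def exp_minus field_simps)
  moreover have "norm (v 1) \<le> 1 + (norm (v 1))\<^sup>2"
    using zero_le_power2[of "norm (v 1) - 1"] norm_ge_zero[of "v 1"]
    unfolding power2_diff by (simp only: mult_1_right power_one)
  ultimately show ?thesis by linarith
qed

text \<open>The constant is fixed before the solution: it is the same however close the segment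
  comes to poles.\<close>

lemma piv_V_bound_on_segment:
  assumes "0 \<le> L"
  obtains C where "\<And>a b x y. norm a \<le> L \<Longrightarrow> norm b \<le> L \<Longrightarrow>
    (\<And>z. z \<in> closed_segment a b \<Longrightarrow> (x has_field_derivative piv_x \<theta> z (x z) (y z)) (at z)) \<Longrightarrow>
    (\<And>z. z \<in> closed_segment a b \<Longrightarrow> (y has_field_derivative piv_y \<kappa> z (x z) (y z)) (at z)) \<Longrightarrow>
    norm (piv_V \<theta> \<kappa> b (x b) (y b)) \<le> (1 + (norm (piv_V \<theta> \<kappa> a (x a) (y a)))\<^sup>2) * C"
proof -
  obtain K where K: "1 \<le> K" "\<And>z x y. norm z \<le> L \<Longrightarrow>
       1 + min (norm x * norm y) ((norm (x - y))\<^sup>2) \<le> K * (1 + norm (piv_V \<theta> \<kappa> z x y))"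
    using piv_min_bound[OF assms, of \<theta> \<kappa>] by metis
  define c where "c = 3 + 2 * L + 2 * norm \<theta> + 2 * norm \<kappa>"
  have c: "c \<ge> 0" using assms by (simp add: c_def)
  define B where "B = 45 * (2 * L * c) * K"
  show thesis
  proof (rule that)
    fix a b x y
    assume a: "norm a \<le> L" and b: "norm b \<le> L"
      and x: "\<And>z. z \<in> closed_segment a b \<Longrightarrow> (x has_field_derivative piv_x \<theta> z (x z) (y z)) (at z)"
      and y: "\<And>z. z \<in> closed_segment a b \<Longrightarrow> (y has_field_derivative piv_y \<kappa> z (x z) (y z)) (at z)"
    define Z where "Z t = a + t *\<^sub>R (b - a)" for t
    define v where "v t = piv_V \<theta> \<kappa> (Z t) (x (Z t)) (y (Z t))" for t
    have "\<exists>D. (v has_vector_derivative D) (at t) \<and> norm D \<le> B * (1 + norm (v t))" if t: "0 \<le> t" "t \<le> 1" for t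
    proof -
      have "Z t = (1 - t) *\<^sub>R a + t *\<^sub>R b" by (simp add: Z_def algebra_simps)
      then have seg: "Z t \<in> closed_segment a b" using t by (auto simp: closed_segment_def)
      have "closed_segment a b \<subseteq> cball 0 L" using a b by (intro closed_segment_subset) auto
      then have ZL: "norm (Z t) \<le> L" using seg by auto
      have Z: "(Z has_vector_derivative (b - a)) (at t)"
        unfolding Z_def by (auto intro!: derivative_eq_intros simp: has_vector_derivative_def)
      interpret P: piv_curve "\<lambda>t. x (Z t)" "\<lambda>t. y (Z t)" Z "b - a" \<theta> \<kappa> t L UNIV
        using field_vector_diff_chain_at[OF Z x[OF seg]] field_vector_diff_chain_at[OF Z y[OF seg]] Z ZL
        by unfold_locales (auto simp: o_def)
      obtain D where D: "(v has_vector_derivative D) (at t)" "norm D \<le> 45 * P.C * (1 + norm (x (Z t)) * norm (y (Z t)))"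
        using P.V'_product_bound unfolding v_def by blast
      obtain D' where D': "(v has_vector_derivative D') (at t)" "norm D' \<le> 45 * P.C * (1 + (norm (x (Z t) - y (Z t)))\<^sup>2)"
        using P.V'_difference_bound unfolding v_def by blast
      \<comment> \<open>Both estimates concern one derivative, so their minimum applies and
        \<open>piv_min_bound\<close> closes the differential inequality.\<close>
      have "D' = D" using vector_derivative_unique_at[OF D'(1) D(1)] .
      then have "norm D \<le> 45 * P.C * (1 + min (norm (x (Z t)) * norm (y (Z t))) ((norm (x (Z t) - y (Z t)))\<^sup>2))"
        using D(2) D'(2) by (simp add: min_def)
      also have "\<dots> \<le> 45 * P.C * (K * (1 + norm (v t)))"
        using K(2)[OF ZL] P.C_ge(2) unfolding v_def by (intro mult_left_mono) auto
      also have "\<dots> \<le> 45 * (2 * L * c) * (K * (1 + norm (v t)))"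
      proof -
        have "norm (b - a) \<le> 2 * L" using norm_triangle_ineq4[of b a] a b by simp
        then have "P.C \<le> 2 * L * c"
          using c unfolding P.C_def P.c_def c_def[symmetric] by (intro mult_right_mono) auto
        then show ?thesis using K(1) by (intro mult_right_mono mult_left_mono) auto
      qed
      finally show ?thesis using D(1) by (intro exI[of _ D]) (simp add: B_def mult_ac)
    qed
    then obtain v' where "\<And>t. 0 \<le> t \<Longrightarrow> t \<le> 1 \<Longrightarrow> (v has_vector_derivative v' t) (at t)"
      "\<And>t. 0 \<le> t \<Longrightarrow> t \<le> 1 \<Longrightarrow> norm (v' t) \<le> B * (1 + norm (v t))" by metis
    from complex_gronwall[OF this]
    show "norm (piv_V \<theta> \<kappa> b (x b) (y b)) \<le> (1 + (norm (piv_V \<theta> \<kappa> a (x a) (y a)))\<^sup>2) * exp (3 * B)"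
      by (simp add: v_def Z_def)
  qed
qed

section \<open>Uniform local meromorphic solutions\<close>

lemma polynomial_rhs_piv: "polynomial_rhs (piv_x \<theta>)" "polynomial_rhs (piv_y \<kappa>)"
proof -
  have "polynomial_rhs (\<lambda>z x y. - x\<^sup>2 + 2 * x * y + 2 * x * z - 2 * \<theta>)"
    "polynomial_rhs (\<lambda>z x y. - y\<^sup>2 + 2 * x * y - 2 * y * z - 2 * \<kappa>)"
    by (intro polynomial_rhs_intros)+
  then show "polynomial_rhs (piv_x \<theta>)" "polynomial_rhs (piv_y \<kappa>)"
    by (simp_all add: piv_x_def[abs_def] piv_y_def[abs_def])
qed

abbreviation piv_ode_at where
  "piv_ode_at \<theta> \<kappa> X Y z \<equiv> (X has_field_derivative piv_x \<theta> z (X z) (Y z)) (at z) \<and>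
     (Y has_field_derivative piv_y \<kappa> z (X z) (Y z)) (at z)"

text \<open>The equations are imposed on punctured neighbourhoods because the values at poles are
  arbitrary here; \<open>remove_sings\<close> normalises them later.\<close>

definition piv_meromorphic_on where
  "piv_meromorphic_on \<theta> \<kappa> S X Y \<longleftrightarrow> X meromorphic_on S \<and> Y meromorphic_on S \<and>
     (\<forall>z\<in>S. \<forall>\<^sub>F w in at z. piv_ode_at \<theta> \<kappa> X Y w)"

definition piv_local_solution where
  "piv_local_solution \<theta> \<kappa> r a p q \<longleftrightarrow> (\<exists>X Y. piv_meromorphic_on \<theta> \<kappa> (ball a r) X Y \<and>
     X analytic_on {a} \<and> Y analytic_on {a} \<and> X a = p \<and> Y a = q)"

lemma piv_local_solution_mono:
  assumes "piv_local_solution \<theta> \<kappa> r a p q" "r' \<le> r"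
  shows "piv_local_solution \<theta> \<kappa> r' a p q"
  using assms meromorphic_on_subset[of _ "ball a r" "ball a r'"] subset_ball[OF assms(2), of a]
  unfolding piv_local_solution_def piv_meromorphic_on_def by blast

text \<open>The order-three symmetry turns the system into itself with new parameters; the 1 in them
  comes from differentiating \<open>- 2 * z\<close>. The way back is
  \<open>x = Y - X + 2 * z\<close>, \<open>y = - X\<close>.\<close>

lemma piv_local_solution_rotate:
  assumes "piv_local_solution (- \<kappa>) (1 + \<theta> - \<kappa>) r a (- q) (p - q - 2 * a)"
  shows "piv_local_solution \<theta> \<kappa> r a p q"
proof -
  obtain X Y where XY: "X meromorphic_on ball a r" "Y meromorphic_on ball a r"
    "\<forall>z\<in>ball a r. \<forall>\<^sub>F w in at z. piv_ode_at (- \<kappa>) (1 + \<theta> - \<kappa>) X Y w"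
    "X analytic_on {a}" "Y analytic_on {a}" "X a = - q" "Y a = p - q - 2 * a"
    using assms unfolding piv_local_solution_def piv_meromorphic_on_def by blast
  define x y where "x z = Y z - X z + 2 * z" and "y z = - X z" for z
  have "piv_ode_at \<theta> \<kappa> x y w" if "piv_ode_at (- \<kappa>) (1 + \<theta> - \<kappa>) X Y w" for w
  proof
    have X: "(X has_field_derivative piv_x (- \<kappa>) w (X w) (Y w)) (at w)"
      and Y: "(Y has_field_derivative piv_y (1 + \<theta> - \<kappa>) w (X w) (Y w)) (at w)" using that by auto
    show "(y has_field_derivative piv_y \<kappa> w (x w) (y w)) (at w)"
      unfolding x_def y_def
      by (rule derivative_eq_intros X refl)+ (simp add: piv_x_def piv_y_def power2_eq_square algebra_simps)
    show "(x has_field_derivative piv_x \<theta> w (x w) (y w)) (at w)"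
      unfolding x_def y_def
      by (rule derivative_eq_intros X Y refl)+ (simp add: piv_x_def piv_y_def power2_eq_square algebra_simps)
  qed
  then have "\<forall>z\<in>ball a r. \<forall>\<^sub>F w in at z. piv_ode_at \<theta> \<kappa> x y w"
    using XY(3) by (auto elim!: eventually_mono)
  moreover have "x meromorphic_on ball a r" "y meromorphic_on ball a r"
    unfolding x_def y_def using XY(1,2) by (auto intro!: meromorphic_intros)
  moreover have "x analytic_on {a}" "y analytic_on {a}"
    unfolding x_def y_def using XY(4,5) by (auto intro!: analytic_intros)
  moreover have "x a = p" "y a = q" by (simp_all add: x_def y_def XY)
  ultimately show ?thesis
    unfolding piv_local_solution_def piv_meromorphic_on_def by blast
qed

lemma piv_local_solution_regular:
  obtains r where "r > 0"
    "\<And>a p q. norm a \<le> M \<Longrightarrow> norm p \<le> M \<Longrightarrow> norm q \<le> M \<Longrightarrow> piv_local_solution \<theta> \<kappa> r a p q"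
proof -
  obtain r where r: "r > 0" "\<And>a p q. norm a \<le> M \<Longrightarrow> norm p \<le> M \<Longrightarrow> norm q \<le> M \<Longrightarrow>
       \<exists>x y. x a = p \<and> y a = q \<and> ode_solution_on (piv_x \<theta>) (piv_y \<kappa>) (ball a r) x y"
    using polynomial_ode_uniform_existence[OF polynomial_rhs_piv] by metis
  show thesis
  proof (rule that[OF r(1)])
    fix a p q :: complex
    assume "norm a \<le> M" "norm p \<le> M" "norm q \<le> M"
    then obtain x y where xy: "x a = p" "y a = q" and sol: "ode_solution_on (piv_x \<theta>) (piv_y \<kappa>) (ball a r) x y"
      using r(2) by blast
    have an: "x analytic_on ball a r" "y analytic_on ball a r"
      using ode_solution_on_holomorphic[OF sol] by (simp_all add: analytic_on_open)
    have "\<forall>\<^sub>F w in at z. piv_ode_at \<theta> \<kappa> x y w" if "z \<in> ball a r" for z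
    proof -
      have "\<forall>\<^sub>F w in at z. w \<in> ball a r"
        using that by (intro eventually_at_in_open') auto
      then show ?thesis
        by eventually_elim (use sol in \<open>auto simp: ode_solution_on_def\<close>)
    qed
    moreover have "x analytic_on {a}" "y analytic_on {a}"
      using an r(1) by (auto elim: analytic_on_subset)
    ultimately show "piv_local_solution \<theta> \<kappa> r a p q"
      unfolding piv_local_solution_def piv_meromorphic_on_def
      using an[THEN analytic_on_imp_meromorphic_on] xy by blast
  qed
qed

section \<open>Local solutions in the pole chart\<close>

lemma has_field_derivative_imp_eventually_nonzero:
  assumes "(f has_field_derivative d) (at z)" "f z \<noteq> 0 \<or> d \<noteq> 0"
  shows "\<forall>\<^sub>F w in at z. f w \<noteq> 0"
proof (cases "f z = 0")
  case False
  have "f \<midarrow>z\<rightarrow> f z" using assms(1) DERIV_isCont isContD by blast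
  then show ?thesis using False tendsto_imp_eventually_ne by blast
next
  case True
  have "((\<lambda>w. (f w - f z) / (w - z)) \<longlongrightarrow> d) (at z)"
    using assms(1) by (simp add: has_field_derivative_iff)
  then have "\<forall>\<^sub>F w in at z. (f w - f z) / (w - z) \<noteq> 0"
    using assms(2) True tendsto_imp_eventually_ne by blast
  then show ?thesis by eventually_elim (auto simp: True)
qed

text \<open>\<open>F\<close> and \<open>G\<close> below are the system in the coordinates \<open>u = 1 / x\<close>, \<open>v = x * (2 * \<kappa> - x * y)\<close>.\<close>

lemma piv_local_solution_pole:
  obtains r where "r > 0"
    "\<And>a p q. norm a \<le> M \<Longrightarrow> p \<noteq> 0 \<Longrightarrow> norm (1 / p) \<le> M \<Longrightarrow> norm (p * (2 * \<kappa> - p * q)) \<le> M \<Longrightarrow>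
       piv_local_solution \<theta> \<kappa> r a p q"
proof -
  define F where "F z u v = 1 - 2 * z * u + (2 * \<theta> - 4 * \<kappa>) * u\<^sup>2 + 2 * u ^ 3 * v" for z u v :: complex
  define G where "G z u v = 2 * z * v + (2 * (u * v) - 2 * \<kappa>) * (4 * \<kappa> - 2 * (u * v) - 2 * \<theta>) + (2 * \<kappa> - u * v)\<^sup>2"
    for z u v :: complex
  have "polynomial_rhs F" "polynomial_rhs G"
    unfolding F_def[abs_def] G_def[abs_def] by (intro polynomial_rhs_intros)+
  from polynomial_ode_uniform_existence[OF this, of M]
  obtain r where r: "r > 0" "\<And>a p q. norm a \<le> M \<Longrightarrow> norm p \<le> M \<Longrightarrow> norm q \<le> M \<Longrightarrow>
       \<exists>x y. x a = p \<and> y a = q \<and> ode_solution_on F G (ball a r) x y"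
    by metis
  show thesis
  proof (rule that[OF r(1)])
    fix a p q :: complex
    assume p: "norm a \<le> M" "p \<noteq> 0" "norm (1 / p) \<le> M" "norm (p * (2 * \<kappa> - p * q)) \<le> M"
    then obtain u v where uv: "u a = 1 / p" "v a = p * (2 * \<kappa> - p * q)"
      and sol: "ode_solution_on F G (ball a r) u v"
      using r(2)[OF p(1,3,4)] by blast
    have an: "u analytic_on ball a r" "v analytic_on ball a r"
      using ode_solution_on_holomorphic[OF sol] by (simp_all add: analytic_on_open)
    have ana: "u analytic_on {a}" "v analytic_on {a}"
      using an r(1) by (auto elim: analytic_on_subset)
    \<comment> \<open>The inverse of the chart: \<open>x * y = 2 * \<kappa> - u * v\<close>, so
      \<open>y\<close> stays holomorphic where \<open>u\<close> vanishes.\<close>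
    define x y where "x z = 1 / u z" and "y z = 2 * \<kappa> * u z - (u z)\<^sup>2 * v z" for z
    have ode: "piv_ode_at \<theta> \<kappa> x y w" if w: "w \<in> ball a r" "u w \<noteq> 0" for w
    proof
      have u: "(u has_field_derivative F w (u w) (v w)) (at w)"
        and v: "(v has_field_derivative G w (u w) (v w)) (at w)"
        using sol w(1) by (auto simp: ode_solution_on_def)
      show "(x has_field_derivative piv_x \<theta> w (x w) (y w)) (at w)"
        unfolding x_def y_def
        by (rule derivative_eq_intros u refl w)+
          (use w(2) in \<open>simp add: piv_x_def F_def power2_eq_square power3_eq_cube field_simps\<close>)
      show "(y has_field_derivative piv_y \<kappa> w (x w) (y w)) (at w)"
        unfolding x_def y_def
        by (rule derivative_eq_intros u v refl w)+
          (use w(2) in \<open>simp add: piv_y_def F_def G_def power2_eq_square power3_eq_cube field_simps\<close>)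
    qed
    have "\<forall>\<^sub>F w in at z. piv_ode_at \<theta> \<kappa> x y w" if z: "z \<in> ball a r" for z
    proof -
      have "\<forall>\<^sub>F w in at z. w \<in> ball a r"
        using z by (intro eventually_at_in_open') auto
      \<comment> \<open>\<open>F\<close> equals 1 where \<open>u = 0\<close>, so zeros of
        \<open>u\<close> are simple and the poles of \<open>x\<close> are isolated.\<close>
      moreover have "\<forall>\<^sub>F w in at z. u w \<noteq> 0"
        by (rule has_field_derivative_imp_eventually_nonzero[of u "F z (u z) (v z)"])
          (use sol z in \<open>auto simp: ode_solution_on_def F_def\<close>)
      ultimately show ?thesis by eventually_elim (rule ode)
    qed
    moreover have "x meromorphic_on ball a r" "y meromorphic_on ball a r"
      unfolding x_def y_def using an[THEN analytic_on_imp_meromorphic_on] by (auto intro!: meromorphic_intros)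
    moreover have "x analytic_on {a}" "y analytic_on {a}"
      unfolding x_def y_def using ana p(2) uv by (auto intro!: analytic_intros)
    moreover have "x a = p" "y a = q"
      using p(2) by (simp_all add: x_def y_def uv power2_eq_square field_simps)
    ultimately show "piv_local_solution \<theta> \<kappa> r a p q"
      unfolding piv_local_solution_def piv_meromorphic_on_def by blast
  qed
qed

section \<open>From bounds on \<open>V\<close> to bounds in the charts\<close>

lemma piv_H_chart:
  "x \<noteq> 0 \<Longrightarrow> x * (2 * \<kappa> - x * y) = piv_H \<theta> \<kappa> z x y - ((x * y)\<^sup>2 / x + 2 * z * (x * y) - 2 * \<theta> * (x * y) / x)"
  by (simp add: piv_H_def field_simps power2_eq_square)

text \<open>By \<open>piv_H_chart\<close> the chart coordinate differs from \<open>H\<close> only by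
  terms in \<open>x * y\<close>, \<open>z\<close> and \<open>1 / x\<close>. So bounds on
  \<open>H\<close> and \<open>x * y\<close> place a point with large \<open>x\<close> in the finite
  part of the chart.\<close>

lemma piv_chart_bound:
  assumes x: "1 \<le> norm x" and z: "norm z \<le> L" and w: "norm (x * y) \<le> W" and H: "norm (piv_H \<theta> \<kappa> z x y) \<le> h"
  shows "norm (x * (2 * \<kappa> - x * y)) \<le> h + (W\<^sup>2 + 2 * L * W + 2 * norm \<theta> * W)"
proof -
  have "x \<noteq> 0" using x by auto
  have W: "0 \<le> W" using w norm_ge_zero order_trans by blast
  have d: "norm (c / x) \<le> norm c" for c
    using x by (simp add: norm_divide divide_le_eq mult_le_cancel_left1)
  show ?thesis
    unfolding piv_H_chart[OF \<open>x \<noteq> 0\<close>, of \<kappa> y \<theta> z]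
  proof (intro order_trans[OF norm_triangle_ineq4] add_mono H norm_triangle_mono order_trans[OF d])
    show "norm ((x * y)\<^sup>2) \<le> W\<^sup>2" unfolding norm_power using w by (intro power_mono) auto
    show "norm (2 * z * (x * y)) \<le> 2 * L * W"
      unfolding norm_mult[of "2 * z"] using z w by (intro mult_mono) (auto simp: norm_mult intro: order_trans[OF norm_ge_zero z])
    show "norm (2 * \<theta> * (x * y)) \<le> 2 * norm \<theta> * W"
      unfolding norm_mult[of "2 * \<theta>"] using w by (intro mult_mono) (auto simp: norm_mult)
  qed
qed

text \<open>The term \<open>- 2 * y\<close> explains the correction in \<open>V\<close>: near
  \<open>d = 0\<close> the rotated Hamiltonian is the bounded one, and \<open>2 * y\<close> differs
  from \<open>x + y\<close> by the bounded \<open>y - x\<close>.\<close>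

lemma piv_H_rotate:
  "piv_H (- \<kappa>) (1 + \<theta> - \<kappa>) z (- y) (x - y - 2 * z) = piv_H \<theta> \<kappa> z x y - 2 * y - 4 * \<kappa> * z"
  by (simp add: piv_H_def algebra_simps)

lemma norm_sum_le_denominator: "norm x + norm y \<le> (norm x)\<^sup>2 + (norm y)\<^sup>2 + (1::real)"
  for x y :: complex
  using zero_le_power2[of "norm x - 1/2"] zero_le_power2[of "norm y - 1/2"]
  by (simp add: power2_diff power2_eq_square algebra_simps)

text \<open>Serves near \<open>x = 0\<close> and \<open>y = 0\<close>, where a bound on
  \<open>x * y\<close> makes \<open>H\<close> bounded along with \<open>V\<close>.\<close>

lemma norm_piv_corr_le_product: "norm (piv_corr x y) \<le> 2 * norm (x * y)"
proof -
  define N where "N = (norm x)\<^sup>2 + (norm y)\<^sup>2 + 1"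
  have N: "N > 0" "norm x + norm y \<le> N"
    using norm_sum_le_denominator[of x y] by (simp_all add: N_def add_nonneg_pos)
  have "norm (2 *\<^sub>R ((norm x)\<^sup>2 *\<^sub>R y + (norm y)\<^sup>2 *\<^sub>R x)) \<le> 2 * ((norm x)\<^sup>2 * norm y + (norm y)\<^sup>2 * norm x)"
    using norm_triangle_ineq[of "(norm x)\<^sup>2 *\<^sub>R y" "(norm y)\<^sup>2 *\<^sub>R x"] by simp
  also have "\<dots> = 2 * (norm (x * y) * (norm x + norm y))"
    by (simp add: norm_mult power2_eq_square algebra_simps)
  also have "\<dots> \<le> 2 * (norm (x * y) * N)"
    using N by (intro mult_left_mono) auto
  finally have "norm (piv_corr x y) \<le> inverse N * (2 * (norm (x * y) * N))"
    using N(1) unfolding piv_corr_def N_def[symmetric] norm_scaleR[of "inverse N"]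
    by (simp only: abs_of_pos positive_imp_inverse_positive) (intro mult_left_mono; simp)
  also have "inverse N * (2 * (norm (x * y) * N)) = 2 * norm (x * y)"
    using N(1) by (simp add: field_simps)
  finally show ?thesis .
qed

text \<open>The counterpart near \<open>d = 0\<close>: there \<open>V\<close> may be exchanged for
  \<open>H - (x + y)\<close> at bounded cost.\<close>

lemma norm_piv_corr_minus_sum_le: "norm (x + y - piv_corr x y) \<le> (norm (x - y))\<^sup>2 + 1"
proof -
  define N where "N = (norm x)\<^sup>2 + (norm y)\<^sup>2 + 1"
  have N: "N > 0" "norm (x + y) \<le> N"
    using norm_sum_le_denominator[of x y] norm_triangle_ineq[of x y] by (simp_all add: N_def add_nonneg_pos)
  let ?R = "((x - y) \<bullet> (x + y)) *\<^sub>R (x - y) + (x + y)"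
  have "norm ?R \<le> (norm (x - y) * norm (x + y)) * norm (x - y) + norm (x + y)"
    using mult_right_mono[OF Cauchy_Schwarz_ineq2[of "x - y" "x + y"] norm_ge_zero[of "x - y"]]
    by (intro norm_triangle_mono) auto
  also have "\<dots> = ((norm (x - y))\<^sup>2 + 1) * norm (x + y)" by (simp add: power2_eq_square algebra_simps)
  also have "\<dots> \<le> ((norm (x - y))\<^sup>2 + 1) * N" using N by (intro mult_left_mono) auto
  finally have R: "norm ?R \<le> ((norm (x - y))\<^sup>2 + 1) * N" .
  have "norm (x + y - piv_corr x y) = inverse N * norm ?R"
    using N(1) unfolding piv_corr_alt N_def[symmetric] by (simp only: diff_diff_eq2 add_diff_cancel_left' norm_scaleR) simp
  also have "\<dots> \<le> inverse N * (((norm (x - y))\<^sup>2 + 1) * N)"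
    using N(1) R by (intro mult_left_mono) auto
  also have "\<dots> = (norm (x - y))\<^sup>2 + 1" using N(1) by (simp add: field_simps)
  finally show ?thesis .
qed

text \<open>Each alternative of \<open>piv_regions\<close> has its chart: \<open>(x, y)\<close>
  itself, or the pole chart after no, one or two rotations. In each the data are bounded, and the
  least of four uniform radii serves.\<close>

lemma piv_local_solution_bounded_V:
  assumes "0 \<le> L"
  obtains r where "r > 0"
    "\<And>a p q. norm a \<le> L \<Longrightarrow> norm (piv_V \<theta> \<kappa> a p q) \<le> B \<Longrightarrow> piv_local_solution \<theta> \<kappa> r a p q"
proof -
  obtain C where C: "1 \<le> C" and reg: "\<And>z x y. norm z \<le> L \<Longrightarrow>
       (norm x \<le> C \<and> norm y \<le> C) \<or>
       (1 \<le> norm x \<and> norm (x * y) \<le> C * (1 + norm (piv_V \<theta> \<kappa> z x y))) \<or>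
       (1 \<le> norm y \<and> norm (x - y - 2 * z) \<le> C * norm y \<and>
          norm (y * (x - y - 2 * z)) \<le> C * (1 + norm (piv_V \<theta> \<kappa> z x y))) \<or>
       (1 \<le> norm y \<and> 1 \<le> norm (x - y - 2 * z) \<and> norm (x - y - 2 * z) \<le> C * norm y \<and>
          norm (x * y) \<le> C * (1 + norm (piv_V \<theta> \<kappa> z x y)))"
    using piv_regions[OF assms, of \<theta> \<kappa>] by metis
  define W where "W = C * (1 + B)"
  define \<theta>1 \<kappa>1 \<theta>2 \<kappa>2 where "\<theta>1 = - \<kappa>" and "\<kappa>1 = 1 + \<theta> - \<kappa>" and "\<theta>2 = - \<kappa>1" and "\<kappa>2 = 1 + \<theta>1 - \<kappa>1"
  define h where "h = B + 4 * W + 4 * (norm \<kappa> + norm \<theta>) * L + (W + 2 * L) + ((W + 2 * L)\<^sup>2 + 1)"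
  \<comment> \<open>After two rotations the relevant product is \<open>d * p\<close> instead of
    \<open>p * q\<close>; using \<open>norm d \<le> C * norm q\<close> costs a factor
    \<open>C\<close>.\<close>
  define W' where "W' = C * W"
  define bd where "bd \<theta> = h + (W'\<^sup>2 + 2 * L * W' + 2 * norm \<theta> * W')" for \<theta> :: complex
  define M where "M = Max {L, C, 1, bd \<theta>, bd \<theta>1, bd \<theta>2}"
  have M: "L \<le> M" "C \<le> M" "1 \<le> M" "bd \<theta> \<le> M" "bd \<theta>1 \<le> M" "bd \<theta>2 \<le> M"
    by (simp_all add: M_def)
  obtain r0 where r0: "r0 > 0"
    "\<And>a p q. norm a \<le> M \<Longrightarrow> norm p \<le> M \<Longrightarrow> norm q \<le> M \<Longrightarrow> piv_local_solution \<theta> \<kappa> r0 a p q"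
    using piv_local_solution_regular by metis
  have pole: "\<exists>r>0. \<forall>a p q. norm a \<le> L \<longrightarrow> 1 \<le> norm p \<longrightarrow> norm (p * q) \<le> W' \<longrightarrow> norm (piv_H \<theta>' \<kappa>' a p q) \<le> h \<longrightarrow>
      piv_local_solution \<theta>' \<kappa>' r a p q" if bdM: "bd \<theta>' \<le> M" for \<theta>' \<kappa>'
  proof -
    obtain r where r: "r > 0"
      "\<And>a p q. norm a \<le> M \<Longrightarrow> p \<noteq> 0 \<Longrightarrow> norm (1 / p) \<le> M \<Longrightarrow> norm (p * (2 * \<kappa>' - p * q)) \<le> M \<Longrightarrow>
       piv_local_solution \<theta>' \<kappa>' r a p q"
      using piv_local_solution_pole by metis
    have "piv_local_solution \<theta>' \<kappa>' r a p q"
      if a: "norm a \<le> L" and p: "1 \<le> norm p" and w: "norm (p * q) \<le> W'" and H: "norm (piv_H \<theta>' \<kappa>' a p q) \<le> h" for a p q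
    proof (rule r(2))
      show "norm a \<le> M" using a M by linarith
      show "p \<noteq> 0" using p by auto
      have "norm (1 / p) \<le> 1" using p by (simp add: norm_divide divide_le_eq_1)
      then show "norm (1 / p) \<le> M" using M by linarith
      show "norm (p * (2 * \<kappa>' - p * q)) \<le> M"
        using piv_chart_bound[OF p a w H] bdM by (simp add: bd_def)
    qed
    then show ?thesis using r(1) by blast
  qed
  obtain r1 where r1: "r1 > 0" "\<And>a p q. norm a \<le> L \<Longrightarrow> 1 \<le> norm p \<Longrightarrow> norm (p * q) \<le> W' \<Longrightarrow>
      norm (piv_H \<theta> \<kappa> a p q) \<le> h \<Longrightarrow> piv_local_solution \<theta> \<kappa> r1 a p q"
    using pole[OF M(4), of \<kappa>] by blast
  obtain r2 where r2: "r2 > 0" "\<And>a p q. norm a \<le> L \<Longrightarrow> 1 \<le> norm p \<Longrightarrow> norm (p * q) \<le> W' \<Longrightarrow>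
      norm (piv_H \<theta>1 \<kappa>1 a p q) \<le> h \<Longrightarrow> piv_local_solution \<theta>1 \<kappa>1 r2 a p q"
    using pole[OF M(5), of \<kappa>1] by blast
  obtain r3 where r3: "r3 > 0" "\<And>a p q. norm a \<le> L \<Longrightarrow> 1 \<le> norm p \<Longrightarrow> norm (p * q) \<le> W' \<Longrightarrow>
      norm (piv_H \<theta>2 \<kappa>2 a p q) \<le> h \<Longrightarrow> piv_local_solution \<theta>2 \<kappa>2 r3 a p q"
    using pole[OF M(6), of \<kappa>2] by blast
  define r where "r = Min {r0, r1, r2, r3}"
  have r: "r > 0" "r \<le> r0" "r \<le> r1" "r \<le> r2" "r \<le> r3"
    using r0(1) r1(1) r2(1) r3(1) by (simp_all add: r_def)
  show thesis
  proof (rule that[OF r(1)])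
    fix a p q
    assume a: "norm a \<le> L" and V: "norm (piv_V \<theta> \<kappa> a p q) \<le> B"
    define d where "d = p - q - 2 * a"
    have B: "0 \<le> B" using V norm_ge_zero order_trans by blast
    then have W: "0 \<le> W" using C by (simp add: W_def)
    have WW': "W \<le> W'" using C W mult_right_mono[of 1 C W] by (simp add: W'_def)
    have bound: "C * (1 + norm (piv_V \<theta> \<kappa> a p q)) \<le> W"
      using C V unfolding W_def by (intro mult_left_mono) auto
    have h: "B + 4 * W + 4 * (norm \<kappa> + norm \<theta>) * L \<le> h" "B + 4 * (norm \<kappa> + norm \<theta>) * L + (W + 2 * L) + ((W + 2 * L)\<^sup>2 + 1) \<le> h"
      using W assms by (simp_all add: h_def)
    have kL: "norm (4 * c * a) \<le> 4 * norm c * L" for c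
      using a by (simp add: norm_mult mult_left_mono)
    have nn: "0 \<le> norm \<kappa> * L" "0 \<le> norm \<theta> * L" using assms by auto
    have H_V: "piv_H \<theta> \<kappa> a p q = piv_V \<theta> \<kappa> a p q + piv_corr p q" by (simp add: piv_V_def)
    have H_le: "norm (piv_H \<theta> \<kappa> a p q) \<le> B + 2 * W" if "norm (p * q) \<le> W"
      unfolding H_V using norm_piv_corr_le_product[of p q] that V
      by (intro norm_triangle_mono) auto
    consider "norm p \<le> C" "norm q \<le> C" | "1 \<le> norm p" "norm (p * q) \<le> W" |
      "1 \<le> norm q" "norm (q * d) \<le> W" |
      "1 \<le> norm q" "1 \<le> norm d" "norm d \<le> C * norm q" "norm (p * q) \<le> W"
      using reg[OF a, of p q] bound unfolding d_def by (elim disjE conjE) linarith+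
    then show "piv_local_solution \<theta> \<kappa> r a p q"
    proof cases
      case 1
      have "piv_local_solution \<theta> \<kappa> r0 a p q"
        by (rule r0(2)) (use 1 a M in linarith)+
      then show ?thesis using r(2) by (rule piv_local_solution_mono)
    next
      case 2
      have "norm (piv_H \<theta> \<kappa> a p q) \<le> h"
        using H_le[OF 2(2)] h(1) W nn by (simp add: algebra_simps)
      then have "piv_local_solution \<theta> \<kappa> r1 a p q"
        using 2 WW' a by (intro r1(2)) auto
      then show ?thesis using r(3) by (rule piv_local_solution_mono)
    next
      case 3
      have d: "norm d \<le> W"
        using 3 mult_right_mono[OF 3(1), of "norm d"] by (simp add: norm_mult)
      have pq: "norm (p - q) \<le> W + 2 * L"
        using norm_triangle_ineq[of d "2 * a"] d a by (simp add: d_def norm_mult)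
      \<comment> \<open>Arranged so that each summand is bounded: \<open>V\<close>, the difference
        \<open>p - q\<close>, and the deviation of the correction from \<open>p + q\<close>.\<close>
      have "piv_H \<theta>1 \<kappa>1 a (- q) d = (piv_V \<theta> \<kappa> a p q - 4 * \<kappa> * a) + (p - q) - (p + q - piv_corr p q)"
        unfolding \<theta>1_def \<kappa>1_def d_def piv_H_rotate H_V by (simp add: algebra_simps)
      also have "norm \<dots> \<le> norm (piv_V \<theta> \<kappa> a p q) + norm (4 * \<kappa> * a) + norm (p - q) + norm (p + q - piv_corr p q)"
        by (intro order_trans[OF norm_triangle_ineq4 add_right_mono] norm_triangle_le add_right_mono norm_triangle_ineq4)
      also have "\<dots> \<le> B + 4 * norm \<kappa> * L + (W + 2 * L) + ((W + 2 * L)\<^sup>2 + 1)"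
      proof (intro add_mono pq V kL)
        have "norm (p + q - piv_corr p q) \<le> (norm (p - q))\<^sup>2 + 1" by (rule norm_piv_corr_minus_sum_le)
        also have "(norm (p - q))\<^sup>2 \<le> (W + 2 * L)\<^sup>2" using pq by (intro power_mono) auto
        finally show "norm (p + q - piv_corr p q) \<le> (W + 2 * L)\<^sup>2 + 1" by simp
      qed
      also have "\<dots> \<le> h" using h(2) nn by (simp add: algebra_simps)
      finally have "norm (piv_H \<theta>1 \<kappa>1 a (- q) d) \<le> h" .
      then have "piv_local_solution \<theta>1 \<kappa>1 r2 a (- q) d"
        using 3 WW' a by (intro r2(2)) auto
      then have "piv_local_solution \<theta> \<kappa> r2 a p q"
        unfolding \<theta>1_def \<kappa>1_def d_def by (rule piv_local_solution_rotate)
      then show ?thesis using r(4) by (rule piv_local_solution_mono)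
    next
      case 4
      have p: "norm p \<le> W"
        using 4 mult_left_mono[OF 4(1), of "norm p"] by (simp add: norm_mult)
      have "norm (d * p) \<le> (C * norm q) * norm p"
        unfolding norm_mult using 4(3) by (rule mult_right_mono) simp
      also have "\<dots> = C * norm (p * q)" by (simp add: norm_mult mult_ac)
      also have "\<dots> \<le> W'" using 4(4) C unfolding W'_def by (intro mult_left_mono) auto
      finally have dp: "norm (d * p) \<le> W'" .
      \<comment> \<open>The second rotation takes \<open>(- q, d)\<close> to
        \<open>(- d, - p)\<close>. The terms \<open>- 2 * q\<close> and \<open>- 2 * d\<close>
        picked up by \<open>H\<close> combine to \<open>- 2 * p\<close> and a multiple of
        \<open>a\<close>, and \<open>p\<close> is bounded here.\<close>
      have e: "- q - d - 2 * a = - p" by (simp add: d_def)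
      have "piv_H \<theta>2 \<kappa>2 a (- d) (- p) = piv_H \<theta> \<kappa> a p q - 2 * q - 4 * \<kappa> * a - 2 * d - 4 * \<kappa>1 * a"
        using piv_H_rotate[of \<kappa>1 \<theta>1 a d "- q"] piv_H_rotate[of \<kappa> \<theta> a q p]
        unfolding e \<theta>2_def \<kappa>2_def by (simp add: \<theta>1_def \<kappa>1_def d_def)
      also have "\<dots> = piv_H \<theta> \<kappa> a p q - 2 * p - 4 * \<theta> * a"
        by (simp add: d_def \<kappa>1_def algebra_simps)
      also have "norm \<dots> \<le> ((B + 2 * W) + 2 * W) + 4 * norm \<theta> * L"
        by (intro order_trans[OF norm_triangle_ineq4] add_mono H_le[OF 4(4)] kL) (use p in \<open>simp add: norm_mult\<close>)
      also have "\<dots> \<le> h" using h(1) nn by (simp add: algebra_simps)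
      finally have "norm (piv_H \<theta>2 \<kappa>2 a (- d) (- p)) \<le> h" .
      then have "piv_local_solution \<theta>2 \<kappa>2 r3 a (- d) (- p)"
        using 4 dp a by (intro r3(2)) auto
      then have "piv_local_solution \<theta>1 \<kappa>1 r3 a (- q) d"
        using piv_local_solution_rotate[of \<kappa>1 \<theta>1 r3 a d "- q"] unfolding e \<theta>2_def \<kappa>2_def by simp
      then have "piv_local_solution \<theta> \<kappa> r3 a p q"
        unfolding \<theta>1_def \<kappa>1_def d_def by (rule piv_local_solution_rotate)
      then show ?thesis using r(5) by (rule piv_local_solution_mono)
    qed
  qed
qed

section \<open>Global continuation\<close>

text \<open>A difference of normal forms need not be in normal form, so the identity theorem is
  applied to its \<open>remove_sings\<close>. This gives agreement on punctured neighbourhoods; the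
  values follow, being 0 at poles and limits elsewhere.\<close>

lemma nicely_meromorphic_on_eqI:
  assumes f: "f nicely_meromorphic_on S" and g: "g nicely_meromorphic_on S"
    and S: "open S" "connected S" "a \<in> S" and eq: "\<forall>\<^sub>F z in at a. f z = g z"
  shows "\<forall>z\<in>S. f z = g z"
proof
  fix z assume z: "z \<in> S"
  let ?h = "\<lambda>z. f z - g z"
  have mero: "?h meromorphic_on S"
    using f g by (intro meromorphic_intros) (auto simp: nicely_meromorphic_on_def)
  have ev: "\<forall>\<^sub>F w in at z. remove_sings ?h w = ?h w" if "z \<in> S" for z
    using eventually_cosparse_imp_eventually_at[OF eventually_remove_sings_eq[OF mero] that] .
  have "\<forall>\<^sub>F w in at a. remove_sings ?h w = 0"
    using ev[OF S(3)] eq by eventually_elim simp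
  then have "\<exists>\<^sub>F w in at a. remove_sings ?h w = 0"
    by (intro eventually_frequently) auto
  then have zero: "remove_sings ?h w = 0" if "w \<in> S" for w
    using frequently_eq_meromorphic_imp_constant[OF _ remove_sings_nicely_meromorphic[OF mero] S(1,2,3)] that
    by blast
  have "\<forall>\<^sub>F w in at z. w \<in> S" using S(1) z by (rule eventually_at_in_open')
  with ev[OF z] have near: "\<forall>\<^sub>F w in at z. f w = g w"
    by eventually_elim (use zero in auto)
  have "is_pole f z \<longleftrightarrow> is_pole g z" by (rule is_pole_cong[OF near refl])
  moreover have "f \<midarrow>z\<rightarrow> c \<longleftrightarrow> g \<midarrow>z\<rightarrow> c" for c by (rule tendsto_cong[OF near])
  moreover have "(is_pole f z \<and> f z = 0) \<or> f \<midarrow>z\<rightarrow> f z" "(is_pole g z \<and> g z = 0) \<or> g \<midarrow>z\<rightarrow> g z"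
    using f g z by (auto simp: nicely_meromorphic_on_def)
  moreover have "\<not> (is_pole f z \<and> f \<midarrow>z\<rightarrow> c)" for c
    unfolding is_pole_def using not_tendsto_and_filterlim_at_infinity[of "at z" f c] by auto
  ultimately show "f z = g z"
    by (metis LIM_unique)
qed

text \<open>
  At a pole a nicely meromorphic function takes the value \<open>0\<close>, so the differential equation is only
  required where both components are analytic.
\<close>

definition piv_solution_on where
  "piv_solution_on \<theta> \<kappa> S X Y \<longleftrightarrow> X nicely_meromorphic_on S \<and> Y nicely_meromorphic_on S \<and>
     (\<forall>z\<in>S. X analytic_on {z} \<longrightarrow> Y analytic_on {z} \<longrightarrow> piv_ode_at \<theta> \<kappa> X Y z)"

section \<open>Solutions in normal form: uniqueness and gluing\<close>

lemma piv_solution_on_subset: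
  "piv_solution_on \<theta> \<kappa> S X Y \<Longrightarrow> T \<subseteq> S \<Longrightarrow> piv_solution_on \<theta> \<kappa> T X Y"
  unfolding piv_solution_on_def using nicely_meromorphic_on_subset by blast

text \<open>Where the normal forms are analytic, both sides of the equations are continuous and
  agree on a punctured neighbourhood, hence also at its centre.\<close>

lemma piv_solution_on_remove_sings:
  assumes "piv_meromorphic_on \<theta> \<kappa> S X Y"
  shows "piv_solution_on \<theta> \<kappa> S (remove_sings X) (remove_sings Y)"
proof -
  let ?X = "remove_sings X" and ?Y = "remove_sings Y"
  have mero: "X meromorphic_on S" "Y meromorphic_on S"
    and ode: "\<And>z. z \<in> S \<Longrightarrow> \<forall>\<^sub>F w in at z. piv_ode_at \<theta> \<kappa> X Y w"
    using assms by (auto simp: piv_meromorphic_on_def)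
  have "piv_ode_at \<theta> \<kappa> ?X ?Y z" if z: "z \<in> S" and an: "?X analytic_on {z}" "?Y analytic_on {z}" for z
  proof -
    have "\<forall>\<^sub>F w in at z. ?X w = X w \<and> ?Y w = Y w \<and> piv_ode_at \<theta> \<kappa> X Y w"
      using eventually_cosparse_imp_eventually_at[OF eventually_remove_sings_eq[OF mero(1)] z]
        eventually_cosparse_imp_eventually_at[OF eventually_remove_sings_eq[OF mero(2)] z] ode[OF z]
      by eventually_elim auto
    then obtain T where T: "open T" "z \<in> T"
      "\<And>w. w \<in> T - {z} \<Longrightarrow> ?X w = X w \<and> ?Y w = Y w \<and> piv_ode_at \<theta> \<kappa> X Y w"
      unfolding eventually_at_topological by blast
    have "piv_ode_at \<theta> \<kappa> ?X ?Y w" if w: "w \<in> T - {z}" for w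
    proof -
      have o: "open (T - {z})" using T(1) by auto
      have "(?X has_field_derivative piv_x \<theta> w (X w) (Y w)) (at w)"
        "(?Y has_field_derivative piv_y \<kappa> w (X w) (Y w)) (at w)"
        using has_field_derivative_transform_within_open[OF _ o w, of X _ ?X]
          has_field_derivative_transform_within_open[OF _ o w, of Y _ ?Y] T(3) w by simp_all
      then show ?thesis using T(3)[OF w] by simp
    qed
    then have near: "\<forall>\<^sub>F w in at z. piv_ode_at \<theta> \<kappa> ?X ?Y w"
      using T(1,2) unfolding eventually_at_topological by (intro exI[of _ T]) auto
    have lim: "?X \<midarrow>z\<rightarrow> ?X z" "?Y \<midarrow>z\<rightarrow> ?Y z"
      using an by (auto intro!: isContD analytic_at_imp_isCont)
    have "((\<lambda>w. piv_x \<theta> w (?X w) (?Y w)) \<longlongrightarrow> piv_x \<theta> z (?X z) (?Y z)) (at z)"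
      "((\<lambda>w. piv_y \<kappa> w (?X w) (?Y w)) \<longlongrightarrow> piv_y \<kappa> z (?X z) (?Y z)) (at z)"
      unfolding piv_x_def piv_y_def by (intro tendsto_intros lim)+
    moreover have "\<forall>\<^sub>F w in at z. piv_x \<theta> w (?X w) (?Y w) = deriv ?X w"
      "\<forall>\<^sub>F w in at z. piv_y \<kappa> w (?X w) (?Y w) = deriv ?Y w"
      using near by (auto elim!: eventually_mono simp: DERIV_imp_deriv)
    ultimately have 1: "deriv ?X \<midarrow>z\<rightarrow> piv_x \<theta> z (?X z) (?Y z)" "deriv ?Y \<midarrow>z\<rightarrow> piv_y \<kappa> z (?X z) (?Y z)"
      by (auto intro: Lim_transform_eventually)
    have 2: "deriv ?X \<midarrow>z\<rightarrow> deriv ?X z" "deriv ?Y \<midarrow>z\<rightarrow> deriv ?Y z"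
      using an by (auto intro!: isContD analytic_at_imp_isCont analytic_deriv)
    have "deriv ?X z = piv_x \<theta> z (?X z) (?Y z)" "deriv ?Y z = piv_y \<kappa> z (?X z) (?Y z)"
      using LIM_unique[OF 2(1) 1(1)] LIM_unique[OF 2(2) 1(2)] by auto
    then show ?thesis
      using an analytic_on_imp_differentiable_at[of ?X "{z}" z] analytic_on_imp_differentiable_at[of ?Y "{z}" z]
      by (metis DERIV_deriv_iff_field_differentiable singletonI)
  qed
  then show ?thesis
    unfolding piv_solution_on_def using mero[THEN remove_sings_nicely_meromorphic] by blast
qed

lemma analytic_at_pair_nbhd:
  assumes "X analytic_on {a}" "Y analytic_on {a}" "open S" "a \<in> S"
  obtains T where "open T" "a \<in> T" "T \<subseteq> S" "\<And>z. z \<in> T \<Longrightarrow> X analytic_on {z} \<and> Y analytic_on {z}"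
proof -
  obtain T1 T2 where "open T1" "a \<in> T1" "X holomorphic_on T1" "open T2" "a \<in> T2" "Y holomorphic_on T2"
    using assms(1,2) unfolding analytic_at by blast
  then show thesis
    using assms(3,4) by (intro that[of "T1 \<inter> T2 \<inter> S"]) (auto simp: analytic_at)
qed

text \<open>Uniqueness for the polynomial system gives agreement near \<open>a\<close>; the identity
  theorem carries it through the poles over the connected \<open>S\<close>.\<close>

lemma piv_solution_on_unique:
  assumes sol: "piv_solution_on \<theta> \<kappa> S X Y" "piv_solution_on \<theta> \<kappa> S X' Y'"
    and S: "open S" "connected S" "a \<in> S"
    and an: "X analytic_on {a}" "Y analytic_on {a}" "X' analytic_on {a}" "Y' analytic_on {a}"
    and init: "X a = X' a" "Y a = Y' a"
  shows "\<forall>z\<in>S. X z = X' z \<and> Y z = Y' z"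
proof -
  obtain T where T: "open T" "a \<in> T" "T \<subseteq> S" "\<And>z. z \<in> T \<Longrightarrow> X analytic_on {z} \<and> Y analytic_on {z}"
    using analytic_at_pair_nbhd[OF an(1,2) S(1,3)] by metis
  obtain T' where T': "open T'" "a \<in> T'" "T' \<subseteq> T" "\<And>z. z \<in> T' \<Longrightarrow> X' analytic_on {z} \<and> Y' analytic_on {z}"
    using analytic_at_pair_nbhd[OF an(3,4) T(1,2)] by metis
  have "ode_solution_on (piv_x \<theta>) (piv_y \<kappa>) T' X Y" "ode_solution_on (piv_x \<theta>) (piv_y \<kappa>) T' X' Y'"
    using sol T T' unfolding ode_solution_on_def piv_solution_on_def by blast+
  from polynomial_ode_unique[OF polynomial_rhs_piv T'(1,2) this init]
  obtain r where r: "r > 0" "\<forall>z\<in>ball a r. X z = X' z \<and> Y z = Y' z" by blast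
  have "\<forall>\<^sub>F z in at a. z \<in> ball a r" using r(1) by (intro eventually_at_in_open') auto
  then have "\<forall>\<^sub>F z in at a. X z = X' z" "\<forall>\<^sub>F z in at a. Y z = Y' z"
    using r(2) by (auto elim!: eventually_mono)
  then show ?thesis
    using nicely_meromorphic_on_eqI[OF _ _ S] sol unfolding piv_solution_on_def by blast
qed

text \<open>All requirements are local, and on the open \<open>S i\<close> the glued pair coincides
  with the pair of index \<open>i\<close>.\<close>

lemma piv_solution_on_glue:
  assumes op: "\<And>i. i \<in> I \<Longrightarrow> open (S i)" and sol: "\<And>i. i \<in> I \<Longrightarrow> piv_solution_on \<theta> \<kappa> (S i) (X i) (Y i)"
    and compat: "\<And>i j z. i \<in> I \<Longrightarrow> j \<in> I \<Longrightarrow> z \<in> S i \<Longrightarrow> z \<in> S j \<Longrightarrow> X i z = X j z \<and> Y i z = Y j z"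
  shows "\<exists>X' Y'. piv_solution_on \<theta> \<kappa> (\<Union>i\<in>I. S i) X' Y' \<and>
    (\<forall>i\<in>I. \<forall>z\<in>S i. X' z = X i z \<and> Y' z = Y i z)"
proof -
  define c where "c z = (SOME i. i \<in> I \<and> z \<in> S i)" for z
  define X' Y' where "X' z = X (c z) z" and "Y' z = Y (c z) z" for z
  have "c z \<in> I \<and> z \<in> S (c z)" if "i \<in> I" "z \<in> S i" for i z
    unfolding c_def by (rule someI[of _ i]) (use that in auto)
  then have eq: "X' z = X i z \<and> Y' z = Y i z" if "i \<in> I" "z \<in> S i" for i z
    using compat that unfolding X'_def Y'_def by blast
  have "piv_solution_on \<theta> \<kappa> (\<Union>i\<in>I. S i) X' Y'"
    unfolding piv_solution_on_def nicely_meromorphic_on_def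
  proof (intro conjI ballI impI; (subst meromorphic_on_meromorphic_at, rule ballI)?)
    fix z assume "z \<in> (\<Union>i\<in>I. S i)"
    then obtain i where i: "i \<in> I" "z \<in> S i" by blast
    have s: "X i nicely_meromorphic_on S i" "Y i nicely_meromorphic_on S i"
      "X i analytic_on {z} \<Longrightarrow> Y i analytic_on {z} \<Longrightarrow> piv_ode_at \<theta> \<kappa> (X i) (Y i) z"
      using sol[OF i(1)] i(2) unfolding piv_solution_on_def by auto
    have "\<forall>\<^sub>F w in nhds z. w \<in> S i" using op[OF i(1)] i(2) by (rule eventually_nhds_in_open)
    then have nh: "\<forall>\<^sub>F w in nhds z. X' w = X i w" "\<forall>\<^sub>F w in nhds z. Y' w = Y i w"
      using eq[OF i(1)] by (auto elim!: eventually_mono)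
    then have at: "\<forall>\<^sub>F w in at z. X' w = X i w" "\<forall>\<^sub>F w in at z. Y' w = Y i w"
      by (auto simp: eventually_nhds_conv_at)
    have m: "X i meromorphic_on {z}" "Y i meromorphic_on {z}"
      using s(1,2) i(2) meromorphic_on_subset[of _ "S i" "{z}"] by (auto simp: nicely_meromorphic_on_def)
    show "X' meromorphic_on {z}" "Y' meromorphic_on {z}"
      using m meromorphic_on_cong[of "{z}" X' "X i", OF _ refl]
        meromorphic_on_cong[of "{z}" Y' "Y i", OF _ refl] at by auto
    have n: "is_pole (X i) z \<and> X i z = 0 \<or> X i \<midarrow>z\<rightarrow> X i z" "is_pole (Y i) z \<and> Y i z = 0 \<or> Y i \<midarrow>z\<rightarrow> Y i z"
      using s(1,2) i(2) by (auto simp: nicely_meromorphic_on_def)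
    show "is_pole X' z \<and> X' z = 0 \<or> X' \<midarrow>z\<rightarrow> X' z" "is_pole Y' z \<and> Y' z = 0 \<or> Y' \<midarrow>z\<rightarrow> Y' z"
      using n is_pole_cong[OF at(1) refl] is_pole_cong[OF at(2) refl] tendsto_cong[OF at(1)] tendsto_cong[OF at(2)]
        eq[OF i] by auto
    assume "X' analytic_on {z}" "Y' analytic_on {z}"
    then have "piv_ode_at \<theta> \<kappa> (X i) (Y i) z"
      using s(3) analytic_at_cong[OF nh(1) refl] analytic_at_cong[OF nh(2) refl] by blast
    then show "(X' has_field_derivative piv_x \<theta> z (X' z) (Y' z)) (at z)"
      "(Y' has_field_derivative piv_y \<kappa> z (X' z) (Y' z)) (at z)"
      using DERIV_cong_ev[OF refl nh(1) refl] DERIV_cong_ev[OF refl nh(2) refl] eq[OF i] by auto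
  qed
  then show ?thesis using eq by blast
qed

text \<open>The candidates for \<open>c\<close> lie on the perpendicular to \<open>w - z0\<close>
  through \<open>w\<close>, and each singularity blocks at most one of them. A compact disc holds
  finitely many singularities, against infinitely many tilts \<open>t\<close>.\<close>

lemma analytic_segment_dense:
  assumes X: "X meromorphic_on ball z0 R" and Y: "Y meromorphic_on ball z0 R"
    and an: "X analytic_on {z0}" "Y analytic_on {z0}"
    and w: "w \<in> ball z0 R" "w \<noteq> z0" and e: "e > 0"
  obtains c where "c \<in> ball z0 R" "dist c w < e"
    "\<And>z. z \<in> closed_segment z0 c \<Longrightarrow> X analytic_on {z} \<and> Y analytic_on {z}"
proof -
  define s where "s = norm (w - z0)"
  have s: "0 < s" "s < R" using w by (auto simp: s_def dist_norm norm_minus_commute)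
  define \<eta> where "\<eta> = min e (R - s) / (2 * s)"
  have \<eta>: "\<eta> > 0" "\<eta> * s < e" "\<eta> * s < R - s"
    using s e by (auto simp: \<eta>_def min_def field_simps)
  define P where "P = {z. \<not> X analytic_on {z}} \<union> {z. \<not> Y analytic_on {z}}"
  have "P sparse_in cball z0 (s + \<eta> * s)"
    unfolding P_def using X Y \<eta> 
    by (intro sparse_in_union' meromorphic_on_imp_sparse_singularities)
      (auto elim!: meromorphic_on_subset)
  then have fin: "finite (cball z0 (s + \<eta> * s) \<inter> P)"
    by (rule sparse_in_compact_finite) simp
  \<comment> \<open>The slope of \<open>p\<close> seen from \<open>z0\<close>, relative to the
    direction of \<open>w\<close>: every point but \<open>z0\<close> of the segment tilted by
    \<open>t\<close> has slope \<open>t\<close>. The point \<open>z0\<close> itself is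
    regular.\<close>
  define q where "q p = Im ((p - z0) / (w - z0)) / Re ((p - z0) / (w - z0))" for p
  have "infinite ({0<..<\<eta>} - q ` (cball z0 (s + \<eta> * s) \<inter> P))"
    using fin \<eta>(1) by (intro Diff_infinite_finite finite_imageI) auto
  then obtain t where t: "0 < t" "t < \<eta>" "t \<notin> q ` (cball z0 (s + \<eta> * s) \<inter> P)"
    by (metis DiffE finite.emptyI ex_in_conv greaterThanLessThan_iff)
  define c where "c = z0 + Complex 1 t * (w - z0)"
  have cw: "dist c w = t * s"
  proof -
    have "c - w = Complex 0 t * (w - z0)" by (simp add: c_def algebra_simps complex_eq_iff)
    then show ?thesis using t(1) by (simp add: dist_norm norm_mult s_def complex_norm)
  qed
  have ts: "t * s < \<eta> * s" using t(2) s(1) by simp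
  have c_norm: "dist z0 c \<le> s + t * s"
    using dist_triangle[of z0 c w] cw by (simp add: s_def dist_norm norm_minus_commute)
  show thesis
  proof (rule that)
    show "c \<in> ball z0 R" using c_norm ts \<eta>(3) by simp
    show "dist c w < e" using cw ts \<eta>(2) by simp
    fix z assume z: "z \<in> closed_segment z0 c"
    have "z \<notin> P"
    proof
      assume "z \<in> P"
      obtain \<mu> where \<mu>: "0 \<le> \<mu>" "\<mu> \<le> 1" "z = (1 - \<mu>) *\<^sub>R z0 + \<mu> *\<^sub>R c"
        using z by (auto simp: closed_segment_def)
      then have zz: "z - z0 = of_real \<mu> * (Complex 1 t * (w - z0))"
        by (simp add: c_def scaleR_conv_of_real algebra_simps)
      have "\<mu> \<noteq> 0" using \<open>z \<in> P\<close> an \<mu>(3) by (auto simp: P_def)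
      have "(z - z0) / (w - z0) = of_real \<mu> * Complex 1 t" using zz w(2) by simp
      then have "q z = t" using \<open>\<mu> \<noteq> 0\<close> by (simp add: q_def)
      moreover have "z \<in> cball z0 (s + \<eta> * s)"
        using dist_in_closed_segment[OF z] c_norm ts by (simp add: dist_commute) 
      ultimately show False using t(3) \<open>z \<in> P\<close> by blast
    qed
    then show "X analytic_on {z} \<and> Y analytic_on {z}" by (simp add: P_def)
  qed
qed

section \<open>Growing discs around the initial point\<close>

definition piv_ivp_solvable where
  "piv_ivp_solvable \<theta> \<kappa> a p q S \<longleftrightarrow> (\<exists>X Y. piv_solution_on \<theta> \<kappa> S X Y \<and>
     X analytic_on {a} \<and> Y analytic_on {a} \<and> X a = p \<and> Y a = q)"

lemma piv_ivp_solvable_subset: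
  "piv_ivp_solvable \<theta> \<kappa> a p q S \<Longrightarrow> T \<subseteq> S \<Longrightarrow> piv_ivp_solvable \<theta> \<kappa> a p q T"
  unfolding piv_ivp_solvable_def using piv_solution_on_subset by blast

lemma piv_local_solution_imp_ivp_solvable:
  assumes "piv_local_solution \<theta> \<kappa> r a p q"
  shows "piv_ivp_solvable \<theta> \<kappa> a p q (ball a r)"
proof -
  obtain X Y where XY: "piv_meromorphic_on \<theta> \<kappa> (ball a r) X Y"
    "X analytic_on {a}" "Y analytic_on {a}" "X a = p" "Y a = q"
    using assms unfolding piv_local_solution_def by blast
  then show ?thesis
    unfolding piv_ivp_solvable_def
    by (intro exI[of _ "remove_sings X"] exI[of _ "remove_sings Y"])
      (auto simp: piv_solution_on_remove_sings remove_sings_analytic_at remove_sings_at_analytic intro: remove_sings_analytic_on)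
qed

text \<open>The gain \<open>\<rho>\<close> is fixed before \<open>R\<close>, so finitely many
  enlargements reach any radius. This is possible because \<open>B\<close> involves only the initial
  value of \<open>V\<close> and a constant for the whole region.\<close>

lemma piv_ivp_extend_ball:
  assumes L: "0 \<le> L"
  obtains \<rho> where "\<rho> > 0"
    "\<And>R. 0 < R \<Longrightarrow> R \<le> L \<Longrightarrow> piv_ivp_solvable \<theta> \<kappa> z0 p q (ball z0 R) \<Longrightarrow>
       piv_ivp_solvable \<theta> \<kappa> z0 p q (ball z0 (R + \<rho>))"
proof -
  define L' where "L' = norm z0 + L"
  have L': "0 \<le> L'" using L by (simp add: L'_def)
  obtain C where C: "\<And>a b x y. norm a \<le> L' \<Longrightarrow> norm b \<le> L' \<Longrightarrow>
    (\<And>z. z \<in> closed_segment a b \<Longrightarrow> (x has_field_derivative piv_x \<theta> z (x z) (y z)) (at z)) \<Longrightarrow>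
    (\<And>z. z \<in> closed_segment a b \<Longrightarrow> (y has_field_derivative piv_y \<kappa> z (x z) (y z)) (at z)) \<Longrightarrow>
    norm (piv_V \<theta> \<kappa> b (x b) (y b)) \<le> (1 + (norm (piv_V \<theta> \<kappa> a (x a) (y a)))\<^sup>2) * C"
    using piv_V_bound_on_segment[OF L', of \<theta> \<kappa>] by metis
  define B where "B = (1 + (norm (piv_V \<theta> \<kappa> z0 p q))\<^sup>2) * C"
  obtain r where r: "r > 0"
    "\<And>a p q. norm a \<le> L' \<Longrightarrow> norm (piv_V \<theta> \<kappa> a p q) \<le> B \<Longrightarrow> piv_local_solution \<theta> \<kappa> r a p q"
    using piv_local_solution_bounded_V[OF L', of \<theta> \<kappa> B] by metis
  show thesis
  proof (rule that)
    show "0 < r / 2" using r(1) by simp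
    fix R assume R: "0 < R" "R \<le> L" and "piv_ivp_solvable \<theta> \<kappa> z0 p q (ball z0 R)"
    then obtain X Y where sol: "piv_solution_on \<theta> \<kappa> (ball z0 R) X Y"
      and an: "X analytic_on {z0}" "Y analytic_on {z0}" and init: "X z0 = p" "Y z0 = q"
      unfolding piv_ivp_solvable_def by blast
    let ?D = "ball z0 R"
    \<comment> \<open>The estimate for \<open>V\<close> applies at points visible from
      \<open>z0\<close> along a segment free of singularities.\<close>
    define G where "G = {c\<in>?D. \<forall>z\<in>closed_segment z0 c. X analytic_on {z} \<and> Y analytic_on {z}}"
    have "\<exists>X' Y'. piv_solution_on \<theta> \<kappa> (ball c r) X' Y' \<and> (\<forall>z\<in>ball c r \<inter> ?D. X' z = X z \<and> Y' z = Y z)"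
      if c: "c \<in> G" for c
    proof -
      have cD: "c \<in> ?D" and seg: "\<And>z. z \<in> closed_segment z0 c \<Longrightarrow> X analytic_on {z} \<and> Y analytic_on {z}"
        using c by (auto simp: G_def)
      have "closed_segment z0 c \<subseteq> ?D" using cD R(1) by (intro closed_segment_subset) auto
      then have ode: "piv_ode_at \<theta> \<kappa> X Y z" if "z \<in> closed_segment z0 c" for z
        using seg[OF that] sol that unfolding piv_solution_on_def by blast
      have "norm c \<le> norm z0 + dist z0 c"
        using norm_triangle_ineq2[of c z0] by (simp add: dist_norm norm_minus_commute)
      then have cL: "norm c \<le> L'" using cD R(2) by (simp add: L'_def)
      have "norm (piv_V \<theta> \<kappa> c (X c) (Y c)) \<le> B"
        using C[of z0 c X Y] cL ode L by (simp add: B_def L'_def init)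
      from piv_local_solution_imp_ivp_solvable[OF r(2)[OF cL this]]
      obtain X' Y' where X': "piv_solution_on \<theta> \<kappa> (ball c r) X' Y'" "X' analytic_on {c}" "Y' analytic_on {c}"
        "X' c = X c" "Y' c = Y c"
        unfolding piv_ivp_solvable_def by blast
      have "\<forall>z\<in>ball c r \<inter> ?D. X' z = X z \<and> Y' z = Y z"
      proof (rule piv_solution_on_unique)
        show "piv_solution_on \<theta> \<kappa> (ball c r \<inter> ?D) X' Y'" "piv_solution_on \<theta> \<kappa> (ball c r \<inter> ?D) X Y"
          using X'(1) sol by (auto elim: piv_solution_on_subset)
        show "connected (ball c r \<inter> ?D)" by (intro convex_connected convex_Int convex_ball)
      qed (use X' cD r(1) seg[of c] in auto)
      then show ?thesis using X'(1) by blast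
    qed
    then obtain Xc Yc where loc: "\<And>c. c \<in> G \<Longrightarrow> piv_solution_on \<theta> \<kappa> (ball c r) (Xc c) (Yc c)"
      and loc_eq: "\<And>c z. c \<in> G \<Longrightarrow> z \<in> ball c r \<Longrightarrow> z \<in> ?D \<Longrightarrow> Xc c z = X z \<and> Yc c z = Y z"
      by (metis IntI)
    \<comment> \<open>Two overlapping discs of equal radius contain the midpoint of their centres, which lies in \<open>?D\<close>
        by convexity.\<close>
    have overlap: "Xc c z = Xc c' z \<and> Yc c z = Yc c' z"
      if c: "c \<in> G" "c' \<in> G" and z: "z \<in> ball c r" "z \<in> ball c' r" for c c' z
    proof -
      let ?T = "ball c r \<inter> ball c' r"
      define m where "m = midpoint c c'"
      have "dist c c' < 2 * r" using dist_triangle_less_add[of c z r c' r] z by (simp add: dist_commute)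
      then have mT: "m \<in> ?T" by (simp add: m_def dist_midpoint dist_commute)
      have "closed_segment c c' \<subseteq> ?D"
        using c by (intro closed_segment_subset) (auto simp: G_def)
      then have mD: "m \<in> ?D" using midpoint_in_closed_segment[of c c'] unfolding m_def by blast
      have "\<forall>\<^sub>F w in at m. w \<in> ?T \<inter> ?D" using mT mD by (intro eventually_at_in_open') auto
      then have ev: "\<forall>\<^sub>F w in at m. Xc c w = Xc c' w" "\<forall>\<^sub>F w in at m. Yc c w = Yc c' w"
        using loc_eq c by (auto elim!: eventually_mono)
      have T: "open ?T" "connected ?T" by (auto intro!: convex_connected convex_Int)
      have sT: "piv_solution_on \<theta> \<kappa> ?T (Xc c) (Yc c)" "piv_solution_on \<theta> \<kappa> ?T (Xc c') (Yc c')"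
        using loc[OF c(1)] loc[OF c(2)] by (auto elim: piv_solution_on_subset)
      then show ?thesis
        using nicely_meromorphic_on_eqI[OF _ _ T mT] ev z unfolding piv_solution_on_def by blast
    qed
    define I where "I = insert None (Some ` G)"
    define S where "S i = (case i of None \<Rightarrow> ?D | Some c \<Rightarrow> ball c r)" for i
    define XI YI where "XI i = (case i of None \<Rightarrow> X | Some c \<Rightarrow> Xc c)" and "YI i = (case i of None \<Rightarrow> Y | Some c \<Rightarrow> Yc c)" for i
    have mem: "(i = None \<and> z \<in> ?D) \<or> (\<exists>c\<in>G. i = Some c \<and> z \<in> ball c r)" if "i \<in> I" "z \<in> S i" for i z
      using that by (cases i) (auto simp: I_def S_def)
    have XI: "XI None = X" "YI None = Y" "XI (Some c) = Xc c" "YI (Some c) = Yc c" for c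
      by (simp_all add: XI_def YI_def)
    have comp: "XI i z = XI j z \<and> YI i z = YI j z" if "i \<in> I" "j \<in> I" "z \<in> S i" "z \<in> S j" for i j z
      using mem[OF that(1,3)] mem[OF that(2,4)]
    proof (elim disjE bexE conjE)
      fix c c' assume "c \<in> G" "i = Some c" "z \<in> ball c r" "c' \<in> G" "j = Some c'" "z \<in> ball c' r"
      then show ?thesis using overlap[of c c' z] by (simp only: XI)
    next
      fix c assume "i = None" "z \<in> ?D" "c \<in> G" "j = Some c" "z \<in> ball c r"
      then show ?thesis using loc_eq[of c z] by (simp only: XI)
    next
      fix c assume "j = None" "z \<in> ?D" "c \<in> G" "i = Some c" "z \<in> ball c r"
      then show ?thesis using loc_eq[of c z] by (simp only: XI)
    qed simp
    have opS: "open (S i)" for i by (simp add: S_def split: option.split)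
    have solI: "piv_solution_on \<theta> \<kappa> (S i) (XI i) (YI i)" if "i \<in> I" for i
      using that sol loc by (cases i) (simp_all add: I_def S_def XI_def YI_def image_iff)
    have "\<exists>X' Y'. piv_solution_on \<theta> \<kappa> (\<Union>i\<in>I. S i) X' Y' \<and>
        (\<forall>i\<in>I. \<forall>z\<in>S i. X' z = XI i z \<and> Y' z = YI i z)"
      by (rule piv_solution_on_glue) (rule opS, rule solI, assumption, rule comp)
    then obtain X' Y' where X': "piv_solution_on \<theta> \<kappa> (\<Union>i\<in>I. S i) X' Y'"
      "\<forall>i\<in>I. \<forall>z\<in>S i. X' z = XI i z \<and> Y' z = YI i z"
      by (elim exE conjE)
    have on_D: "X' z = X z \<and> Y' z = Y z" if "z \<in> ?D" for z
      using bspec[OF bspec[OF X'(2), of None], of z] that by (simp add: I_def S_def XI)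
    have cover: "ball z0 (R + r / 2) \<subseteq> (\<Union>i\<in>I. S i)"
    proof
      fix w assume w: "w \<in> ball z0 (R + r / 2)"
      show "w \<in> (\<Union>i\<in>I. S i)"
      proof (cases "w \<in> ?D")
        case True
        then show ?thesis by (auto simp: I_def S_def)
      next
        case False
        define n where "n = norm (w - z0)"
        have n: "R \<le> n" "n < R + r / 2" "n > 0"
          using False w R(1) by (auto simp: n_def dist_norm norm_minus_commute)
        \<comment> \<open>\<open>w'\<close> lies at radius \<open>s\<close> in the direction of
          \<open>w\<close>. It is less than \<open>3 * r / 4\<close> from \<open>w\<close> and less
          than \<open>r / 4\<close> from \<open>c\<close>, hence the gain \<open>r / 2\<close>. The
          term \<open>R / 2\<close> keeps \<open>s\<close> positive for small \<open>R\<close>, so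
          \<open>w'\<close> differs from \<open>z0\<close>.\<close>
        define s where "s = max (R / 2) (R - r / 4)"
        have s: "0 < s" "s < R" "R - r / 4 \<le> s" using R(1) r(1) by (auto simp: s_def)
        define w' where "w' = z0 + (s / n) *\<^sub>R (w - z0)"
        have "w - w' = (1 - s / n) *\<^sub>R (w - z0)" by (simp add: w'_def algebra_simps)
        then have "dist w' w = \<bar>1 - s / n\<bar> * n" 
          unfolding dist_commute[of w'] by (simp add: n_def dist_norm)
        also have "\<dots> = n - s" using n s by (simp add: abs_of_nonneg field_simps)
        finally have ww': "dist w' w = n - s" .
        have w'D: "w' \<in> ?D" "w' \<noteq> z0"
          using n s by (auto simp: w'_def dist_norm n_def)
        have mero: "X meromorphic_on ?D" "Y meromorphic_on ?D"
          using sol by (auto simp: piv_solution_on_def nicely_meromorphic_on_def)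
        obtain c where c: "c \<in> ?D" "dist c w' < r / 4"
          "\<And>z. z \<in> closed_segment z0 c \<Longrightarrow> X analytic_on {z} \<and> Y analytic_on {z}"
          using analytic_segment_dense[OF mero an w'D, of "r / 4"] r(1) by auto
        have "c \<in> G" using c by (auto simp: G_def)
        moreover have "dist c w < r" using dist_triangle[of c w w'] c(2) ww' n s by linarith
        ultimately show ?thesis by (auto simp: I_def S_def)
      qed
    qed
    have "z0 \<in> ?D" using R(1) by simp
    then have "\<forall>\<^sub>F z in nhds z0. z \<in> ?D" by (intro eventually_nhds_in_open) auto
    then have "\<forall>\<^sub>F z in nhds z0. X' z = X z" "\<forall>\<^sub>F z in nhds z0. Y' z = Y z"
      using on_D by (auto elim!: eventually_mono)
    then have "X' analytic_on {z0}" "Y' analytic_on {z0}"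
      using an by (simp_all add: analytic_at_cong)
    then show "piv_ivp_solvable \<theta> \<kappa> z0 p q (ball z0 (R + r / 2))"
      unfolding piv_ivp_solvable_def
      using piv_solution_on_subset[OF X'(1) cover] on_D[OF \<open>z0 \<in> ?D\<close>] init by metis
  qed
qed

lemma piv_ivp_all_balls:
  assumes R: "0 < R" "piv_ivp_solvable \<theta> \<kappa> z0 p q (ball z0 R)"
  shows "piv_ivp_solvable \<theta> \<kappa> z0 p q (ball z0 L)"
proof (cases "L \<le> R")
  case True
  then show ?thesis by (intro piv_ivp_solvable_subset[OF R(2)]) auto
next
  case False
  then have "0 \<le> L" using R(1) by simp
  then obtain \<rho> where \<rho>: "\<rho> > 0"
    "\<And>R. 0 < R \<Longrightarrow> R \<le> L \<Longrightarrow> piv_ivp_solvable \<theta> \<kappa> z0 p q (ball z0 R) \<Longrightarrow>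
       piv_ivp_solvable \<theta> \<kappa> z0 p q (ball z0 (R + \<rho>))"
    using piv_ivp_extend_ball[of L \<theta> \<kappa> z0 p q] by metis
  \<comment> \<open>The cut-off at \<open>L\<close> keeps every radius in the range for which
    \<open>\<rho>\<close> was obtained.\<close>
  have step: "piv_ivp_solvable \<theta> \<kappa> z0 p q (ball z0 (min L (R + real n * \<rho>)))" for n
  proof (induction n)
    case 0
    show ?case using R(2) by (rule piv_ivp_solvable_subset) auto
  next
    case (Suc n)
    have "0 < min L (R + real n * \<rho>)" using False R(1) \<rho>(1) by (simp add: add_pos_nonneg)
    then have "piv_ivp_solvable \<theta> \<kappa> z0 p q (ball z0 (min L (R + real n * \<rho>) + \<rho>))"
      by (rule \<rho>(2)) (use Suc in auto)
    then show ?case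
      by (rule piv_ivp_solvable_subset) (use \<rho>(1) in \<open>auto simp: algebra_simps min_def split: if_splits\<close>)
  qed
  obtain n where "L / \<rho> < real n" using reals_Archimedean2 by blast
  then have "min L (R + real n * \<rho>) = L" using \<rho>(1) R(1) by (simp add: field_simps)
  then show ?thesis using step[of n] by simp
qed

lemma piv_ivp_global:
  assumes R: "0 < R" "piv_ivp_solvable \<theta> \<kappa> z0 p q (ball z0 R)"
  shows "piv_ivp_solvable \<theta> \<kappa> z0 p q UNIV"
proof -
  \<comment> \<open>The summand 1 puts \<open>z0\<close> into every disc, also for
    \<open>n = 0\<close>; solutions on different discs are compared there.\<close>
  have "\<forall>n::nat. \<exists>X Y. piv_solution_on \<theta> \<kappa> (ball z0 (real n + 1)) X Y \<and>
      X analytic_on {z0} \<and> Y analytic_on {z0} \<and> X z0 = p \<and> Y z0 = q"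
    using piv_ivp_all_balls[OF R] unfolding piv_ivp_solvable_def by blast
  then obtain X Y where sol: "\<And>n::nat. piv_solution_on \<theta> \<kappa> (ball z0 (real n + 1)) (X n) (Y n)"
    and an: "\<And>n. X n analytic_on {z0}" "\<And>n. Y n analytic_on {z0}" and init: "\<And>n. X n z0 = p" "\<And>n. Y n z0 = q"
    by metis
  have compat: "X m z = X n z \<and> Y m z = Y n z"
    if "z \<in> ball z0 (real m + 1)" "z \<in> ball z0 (real n + 1)" for m n z
  proof -
    let ?T = "ball z0 (real m + 1) \<inter> ball z0 (real n + 1)"
    have "\<forall>z\<in>?T. X m z = X n z \<and> Y m z = Y n z"
    proof (rule piv_solution_on_unique[where a = z0])
      show "piv_solution_on \<theta> \<kappa> ?T (X m) (Y m)" "piv_solution_on \<theta> \<kappa> ?T (X n) (Y n)"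
        using sol[of m] sol[of n] by (auto elim: piv_solution_on_subset)
      show "connected ?T" by (intro convex_connected convex_Int convex_ball)
    qed (auto simp: an init add_nonneg_pos)
    then show ?thesis using that by blast
  qed
  have "\<exists>X' Y'. piv_solution_on \<theta> \<kappa> (\<Union>n::nat. ball z0 (real n + 1)) X' Y' \<and>
      (\<forall>n\<in>UNIV. \<forall>z\<in>ball z0 (real n + 1). X' z = X n z \<and> Y' z = Y n z)"
    by (rule piv_solution_on_glue) (rule open_ball, rule sol, rule compat)
  then obtain X' Y' where X': "piv_solution_on \<theta> \<kappa> (\<Union>n::nat. ball z0 (real n + 1)) X' Y'"
    "\<And>n z. z \<in> ball z0 (real n + 1) \<Longrightarrow> X' z = X n z \<and> Y' z = Y n z"
    by blast
  have "(\<Union>n::nat. ball z0 (real n + 1)) = UNIV"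
  proof -
    have "\<exists>n::nat. z \<in> ball z0 (real n + 1)" for z
    proof -
      obtain n :: nat where "dist z0 z < real n" using reals_Archimedean2 by blast
      then show ?thesis by (intro exI[of _ n]) simp
    qed
    then show ?thesis by blast
  qed
  moreover have "\<forall>\<^sub>F z in nhds z0. z \<in> ball z0 (real 0 + 1)" by (intro eventually_nhds_in_open) auto
  then have "\<forall>\<^sub>F z in nhds z0. X' z = X 0 z" "\<forall>\<^sub>F z in nhds z0. Y' z = Y 0 z"
    using X'(2)[of _ 0] by (auto elim!: eventually_mono)
  then have "X' analytic_on {z0}" "Y' analytic_on {z0}"
    using an[of 0] by (simp_all add: analytic_at_cong)
  moreover have "X' z0 = p" "Y' z0 = q" using X'(2)[of z0 0] init by auto
  ultimately show ?thesis using X'(1) unfolding piv_ivp_solvable_def by metis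
qed

section \<open>Transfer to a solution given on a connected open set\<close>

lemma painleve_IV_solution_on_iff:
  "painleve_IV_solution_on \<theta> \<kappa> U x y \<longleftrightarrow> (\<forall>z\<in>U. piv_ode_at \<theta> \<kappa> x y z)"
  by (simp add: painleve_IV_solution_on_def piv_x_def piv_y_def)

theorem theorem3p8:
  fixes \<theta> \<kappa> z\<^sub>0 x\<^sub>0 y\<^sub>0 :: complex
    and U :: "complex set"
    and x y :: "complex \<Rightarrow> complex"
  assumes "open U" and "connected U" and "z\<^sub>0 \<in> U"
    and "painleve_IV_solution_on \<theta> \<kappa> U x y"
    and "x z\<^sub>0 = x\<^sub>0" and "y z\<^sub>0 = y\<^sub>0"
  shows "\<exists>X Y. X nicely_meromorphic_on UNIV \<and> Y nicely_meromorphic_on UNIV \<and>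
           (\<forall>z\<in>U. X z = x z \<and> Y z = y z)"
proof -
  have ode: "\<And>z. z \<in> U \<Longrightarrow> piv_ode_at \<theta> \<kappa> x y z"
    using assms(4) by (simp add: painleve_IV_solution_on_iff)
  then have "ode_solution_on (piv_x \<theta>) (piv_y \<kappa>) U x y" by (simp add: ode_solution_on_def)
  then have an: "x analytic_on U" "y analytic_on U"
    using ode_solution_on_holomorphic assms(1) by (simp_all add: analytic_on_open)
  then have sol: "piv_solution_on \<theta> \<kappa> U x y"
    using ode by (simp add: piv_solution_on_def analytic_on_imp_nicely_meromorphic_on)
  have an0: "x analytic_on {z\<^sub>0}" "y analytic_on {z\<^sub>0}"
    using an assms(3) by (auto elim: analytic_on_subset)
  obtain R where R: "0 < R" "ball z\<^sub>0 R \<subseteq> U"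
    using assms(1,3) open_contains_ball by blast
  have "piv_ivp_solvable \<theta> \<kappa> z\<^sub>0 x\<^sub>0 y\<^sub>0 (ball z\<^sub>0 R)"
    unfolding piv_ivp_solvable_def using piv_solution_on_subset[OF sol R(2)] an0 assms(5,6) by blast
  from piv_ivp_global[OF R(1) this]
  obtain X Y where XY: "piv_solution_on \<theta> \<kappa> UNIV X Y" "X analytic_on {z\<^sub>0}" "Y analytic_on {z\<^sub>0}"
    "X z\<^sub>0 = x\<^sub>0" "Y z\<^sub>0 = y\<^sub>0"
    unfolding piv_ivp_solvable_def by blast
  \<comment> \<open>The global pair stems from a small disc about \<open>z\<^sub>0\<close>;
    connectedness of \<open>U\<close> extends the agreement to all of \<open>U\<close>.\<close>
  have "\<forall>z\<in>U. X z = x z \<and> Y z = y z"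
    by (rule piv_solution_on_unique[OF piv_solution_on_subset[OF XY(1)] sol assms(1-3) XY(2,3) an0])
      (use XY(4,5) assms(5,6) in auto)
  then show ?thesis using XY(1) unfolding piv_solution_on_def by blast
qed

end
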